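(* Let $k\ge 0$ be an integer. Let $\mathcal{B}$ be a topos model of synthetic differential geometry, and for each base object (manifold) $B$ let $J^k_B=\Pi_d\circ c^*:\mathcal{B}/B\to\mathcal{B}/B$ be the $k$th order jet bundle functor. Then the functors $(J^k_B)^{op}:(\mathcal{B}/B)^{op}\to(\mathcal{B}/B)^{op}$ are the fibres of an endofunctor $J^k:(\mathcal{B}^2)^*\to(\mathcal{B}^2)^*$ over the category of base objects; that is, there is an endofunctor $J^k$ of $(\mathcal{B}^2)^*$, commuting with the projection to the base, whose restriction to the fibre over $B$, identified with $(\mathcal{B}/B)^{op}$, is $(J^k_B)^{op}$ for every base object $B$.
   Context: Setting. $\mathcal{B}$ is a topos (in particular locally Cartesian closed, with finite limits) which is a model of synthetic differential geometry and contains the smooth manifolds as a full subcategory. The base objects $A,B,\dots$ are the manifolds, and the arrows between base objects are all arrows of $\mathcal{B}$ between them; the objects $E$ of bundles $E\to B$ over a base object may be arbitrary objects of $\mathcal{B}$, so that the fibre over $B$ of the codomain fibration is the whole slice $\mathcal{B}/B$. Neighbourhoods of the diagonal. For each base object $B$, $B_{(k)}\subseteq B\times B$ denotes the $k$th neighbourhood of the diagonal, consisting (in generalized-element language) of the pairs $(b,b')$ with $b'\in\mathfrak{M}_k(b)$, where $\mathfrak{M}_k(b)\subseteq B$ is the $k$th order infinitesimal neighbourhood ($k$-monad) of $b$. (For $B=R^n$, $R$ the line object, $b'\in\mathfrak{M}_k(b)$ iff every product of $k+1$ coordinates of $b'-b$ is $0$; for a general manifold it is defined via coordinate charts.) One has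 $b\in\mathfrak{M}_k(b)$, i.e. $B_{(k)}$ contains the diagonal, and for every arrow $\alpha:A\to B$ between base objects, $\alpha\times\alpha$ restricts to an arrow $\overline{\alpha}:A_{(k)}\to B_{(k)}$ (equivalently, $\alpha$ maps $\mathfrak{M}_k(a)$ into $\mathfrak{M}_k(\alpha(a))$). Write $d,c:B_{(k)}\to B$ for the restrictions of the two projections, $d(b,b')=b$ and $c(b,b')=b'$. Jet functor. For each base object $B$, $c^*:\mathcal{B}/B\to\mathcal{B}/B_{(k)}$ is pull-back along $c$, and $\Pi_d:\mathcal{B}/B_{(k)}\to\mathcal{B}/B$ is the right adjoint of pull-back along $d$; $J^k_B=\Pi_d\circ c^*$. In generalized-element terms, the fibre over $b$ of $J^k_B(E\to B)$ is the object of maps $s:\mathfrak{M}_k(b)\to E$ whose composite with $E\to B$ is the inclusion $\mathfrak{M}_k(b)\to B$ ($k$-jets at $b$ of sections), and $J^k_B(f)$ is post-composition with $f$. Fibrewise dual. $\mathcal{B}^2$ is the category of arrows of $\mathcal{B}$ with base-object codomain (arrows are commutative squares), fibred over the category of base objects by the codomain functor; Cartesian arrows are pull-back squares, and the fibre over $B$ is $\mathcal{B}/B$. Its fibrewise dual $(\mathcal{B}^2)^*$ has the same objects. An arrow ("comorphism") of $(\mathcal{B}^2)^*$ over $\alpha:A\to B$ from $x:X\to A$ to $y:Y\to B$ is given by an arrow $v:\alpha^*(Y)\to X$ in $\mathcal{B}/A$, where $\alpha^*(Y)\to A$ is the (chosen) pull-back of $y$ along $\alpha$; in generalized-element terms,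 a family of maps $f_a:Y_{\alpha(a)}\to X_a$, $a\in A$. The composite of $f$ over $\alpha:A\to B$ from $X$ to $Y$ followed by $g$ over $\beta:B\to C$ from $Y$ to $Z$ is the comorphism $h$ from $X$ to $Z$ over the composite $A\to C$ of $\alpha$ and $\beta$, given by $h_a(z)=f_a(g_{\alpha(a)}(z))$ for $z\in Z_{\beta(\alpha(a))}$, i.e. $\alpha^*(\beta^*Z)\xrightarrow{\alpha^*(g)}\alpha^*Y\xrightarrow{f}X$ modulo the canonical isomorphism between $\alpha^*\beta^*Z$ and the pull-back of $Z$ along the composite. The projection to the base sends $x:X\to A$ to $A$ and a comorphism over $\alpha$ to $\alpha$; its fibre over $A$ is $(\mathcal{B}/A)^{op}$. *)

theory Defs
  imports "HOL-Analysis.Analysis"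
begin

section \<open>Categories and functors\<close>

record ('o, 'a) cat =
  Obj :: "'o set"
  Arr :: "'a set"
  Dom :: "'a \<Rightarrow> 'o"
  Cod :: "'a \<Rightarrow> 'o"
  Ident :: "'o \<Rightarrow> 'a"
  Comp :: "'a \<Rightarrow> 'a \<Rightarrow> 'a" (infixr "\<cdot>\<index>" 75)

definition hom_set :: "('o, 'a) cat \<Rightarrow> 'o \<Rightarrow> 'o \<Rightarrow> 'a set" where
  "hom_set C X Y = {f \<in> Arr C. Dom C f = X \<and> Cod C f = Y}"

definition is_category :: "('o, 'a) cat \<Rightarrow> bool" where
  "is_category C \<longleftrightarrow>
     (\<forall>f\<in>Arr C. Dom C f \<in> Obj C \<and> Cod C f \<in> Obj C) \<and>
     (\<forall>X\<in>Obj C. Ident C X \<in> hom_set C X X) \<and>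
     (\<forall>X\<in>Obj C. \<forall>Y\<in>Obj C. \<forall>Z\<in>Obj C. \<forall>f\<in>hom_set C X Y. \<forall>g\<in>hom_set C Y Z.
        g \<cdot>\<^bsub>C\<^esub> f \<in> hom_set C X Z) \<and>
     (\<forall>f\<in>Arr C. f \<cdot>\<^bsub>C\<^esub> Ident C (Dom C f) = f \<and> Ident C (Cod C f) \<cdot>\<^bsub>C\<^esub> f = f) \<and>
     (\<forall>f\<in>Arr C. \<forall>g\<in>Arr C. \<forall>h\<in>Arr C. Cod C f = Dom C g \<longrightarrow> Cod C g = Dom C h \<longrightarrow>
        (h \<cdot>\<^bsub>C\<^esub> g) \<cdot>\<^bsub>C\<^esub> f = h \<cdot>\<^bsub>C\<^esub> (g \<cdot>\<^bsub>C\<^esub> f))"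

record ('o, 'a, 'p, 'b) fctr =
  fobj :: "'o \<Rightarrow> 'p"
  farr :: "'a \<Rightarrow> 'b"

definition is_functor ::
  "('o, 'a) cat \<Rightarrow> ('p, 'b) cat \<Rightarrow> ('o, 'a, 'p, 'b) fctr \<Rightarrow> bool" where
  "is_functor C D F \<longleftrightarrow>
     (\<forall>X\<in>Obj C. fobj F X \<in> Obj D) \<and>
     (\<forall>f\<in>Arr C. farr F f \<in> hom_set D (fobj F (Dom C f)) (fobj F (Cod C f))) \<and>
     (\<forall>X\<in>Obj C. farr F (Ident C X) = Ident D (fobj F X)) \<and>
     (\<forall>f\<in>Arr C. \<forall>g\<in>Arr C. Cod C f = Dom C g \<longrightarrow>
        farr F (g \<cdot>\<^bsub>C\<^esub> f) = farr F g \<cdot>\<^bsub>D\<^esub> farr F f)"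

definition fully_faithful ::
  "('o, 'a) cat \<Rightarrow> ('p, 'b) cat \<Rightarrow> ('o, 'a, 'p, 'b) fctr \<Rightarrow> bool" where
  "fully_faithful C D F \<longleftrightarrow>
     (\<forall>X\<in>Obj C. \<forall>Y\<in>Obj C. bij_betw (farr F) (hom_set C X Y) (hom_set D (fobj F X) (fobj F Y)))"

definition is_isomorphism ::
  "('o, 'a) cat \<Rightarrow> ('p, 'b) cat \<Rightarrow> ('o, 'a, 'p, 'b) fctr \<Rightarrow> bool" where
  "is_isomorphism C D F \<longleftrightarrow> is_functor C D F \<and>
     bij_betw (fobj F) (Obj C) (Obj D) \<and> bij_betw (farr F) (Arr C) (Arr D)"

definition fctr_comp ::
  "('p, 'b, 'q, 'c) fctr \<Rightarrow> ('o, 'a, 'p, 'b) fctr \<Rightarrow> ('o, 'a, 'q, 'c) fctr" where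
  "fctr_comp G F = \<lparr>fobj = fobj G \<circ> fobj F, farr = farr G \<circ> farr F\<rparr>"

text \<open>Functors are given by total functions, so they are compared on the domain category only.\<close>

definition functor_eq ::
  "('o, 'a) cat \<Rightarrow> ('o, 'a, 'p, 'b) fctr \<Rightarrow> ('o, 'a, 'p, 'b) fctr \<Rightarrow> bool" where
  "functor_eq C F G \<longleftrightarrow> (\<forall>X\<in>Obj C. fobj F X = fobj G X) \<and> (\<forall>f\<in>Arr C. farr F f = farr G f)"

definition dual :: "('o, 'a) cat \<Rightarrow> ('o, 'a) cat" where
  "dual C = \<lparr>Obj = Obj C, Arr = Arr C, Dom = Cod C, Cod = Dom C, Ident = Ident C,
             Comp = (\<lambda>g f. f \<cdot>\<^bsub>C\<^esub> g)\<rparr>"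

text \<open>
  The arrows of \<open>dual C\<close> are those of \<open>C\<close>, so a functor and its opposite have the same object and
  arrow maps.
\<close>

definition dual_fctr :: "('o, 'a, 'p, 'b) fctr \<Rightarrow> ('o, 'a, 'p, 'b) fctr" where
  "dual_fctr F = F"

definition full_subcat :: "('o, 'a) cat \<Rightarrow> 'o set \<Rightarrow> ('o, 'a) cat" where
  "full_subcat C S = C\<lparr>Obj := S, Arr := {f \<in> Arr C. Dom C f \<in> S \<and> Cod C f \<in> S}\<rparr>"

text \<open>\<open>R : D \<rightarrow> C\<close> is right adjoint to \<open>L : C \<rightarrow> D\<close>, by means of a universal counit.\<close>

definition right_adjoint ::
  "('o, 'a) cat \<Rightarrow> ('p, 'b) cat \<Rightarrow> ('o, 'a, 'p, 'b) fctr \<Rightarrow> ('p, 'b, 'o, 'a) fctr \<Rightarrow> bool" where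
  "right_adjoint C D L R \<longleftrightarrow> is_functor D C R \<and>
     (\<exists>\<epsilon>. (\<forall>Y\<in>Obj D. \<epsilon> Y \<in> hom_set D (fobj L (fobj R Y)) Y) \<and>
          (\<forall>h\<in>Arr D. h \<cdot>\<^bsub>D\<^esub> \<epsilon> (Dom D h) = \<epsilon> (Cod D h) \<cdot>\<^bsub>D\<^esub> farr L (farr R h)) \<and>
          (\<forall>X\<in>Obj C. \<forall>Y\<in>Obj D. \<forall>f\<in>hom_set D (fobj L X) Y.
             \<exists>!g. g \<in> hom_set C X (fobj R Y) \<and> \<epsilon> Y \<cdot>\<^bsub>D\<^esub> farr L g = f))"


section \<open>Limits and elementary toposes\<close>

definition is_terminal :: "('o, 'a) cat \<Rightarrow> 'o \<Rightarrow> bool" where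
  "is_terminal C T \<longleftrightarrow> T \<in> Obj C \<and> (\<forall>X\<in>Obj C. \<exists>!f. f \<in> hom_set C X T)"

text \<open>\<open>p\<close> and \<open>q\<close> have codomains \<open>Dom f\<close> and \<open>Dom g\<close>, respectively.\<close>

definition is_pullback :: "('o, 'a) cat \<Rightarrow> 'a \<Rightarrow> 'a \<Rightarrow> 'a \<Rightarrow> 'a \<Rightarrow> bool" where
  "is_pullback C f g p q \<longleftrightarrow>
     f \<in> Arr C \<and> g \<in> Arr C \<and> Cod C f = Cod C g \<and>
     p \<in> hom_set C (Dom C p) (Dom C f) \<and> q \<in> hom_set C (Dom C p) (Dom C g) \<and>
     f \<cdot>\<^bsub>C\<^esub> p = g \<cdot>\<^bsub>C\<^esub> q \<and>
     (\<forall>X\<in>Obj C. \<forall>a\<in>hom_set C X (Dom C f). \<forall>b\<in>hom_set C X (Dom C g). f \<cdot>\<^bsub>C\<^esub> a = g \<cdot>\<^bsub>C\<^esub> b \<longrightarrow>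
        (\<exists>!h. h \<in> hom_set C X (Dom C p) \<and> p \<cdot>\<^bsub>C\<^esub> h = a \<and> q \<cdot>\<^bsub>C\<^esub> h = b))"

definition is_product :: "('o, 'a) cat \<Rightarrow> 'o \<Rightarrow> 'i set \<Rightarrow> ('i \<Rightarrow> 'a) \<Rightarrow> ('i \<Rightarrow> 'o) \<Rightarrow> bool" where
  "is_product C P I p Y \<longleftrightarrow> P \<in> Obj C \<and> (\<forall>i\<in>I. Y i \<in> Obj C \<and> p i \<in> hom_set C P (Y i)) \<and>
     (\<forall>X\<in>Obj C. \<forall>f. (\<forall>i\<in>I. f i \<in> hom_set C X (Y i)) \<longrightarrow>
        (\<exists>!h. h \<in> hom_set C X P \<and> (\<forall>i\<in>I. p i \<cdot>\<^bsub>C\<^esub> h = f i)))"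

definition is_binary_product :: "('o, 'a) cat \<Rightarrow> 'o \<Rightarrow> 'o \<Rightarrow> 'o \<Rightarrow> 'a \<Rightarrow> 'a \<Rightarrow> bool" where
  "is_binary_product C X Y P p q \<longleftrightarrow>
     is_product C P UNIV (\<lambda>i. if i then p else q) (\<lambda>i. if i then X else Y)"

definition is_mono :: "('o, 'a) cat \<Rightarrow> 'a \<Rightarrow> bool" where
  "is_mono C m \<longleftrightarrow> m \<in> Arr C \<and>
     (\<forall>X\<in>Obj C. \<forall>a\<in>hom_set C X (Dom C m). \<forall>b\<in>hom_set C X (Dom C m).
        m \<cdot>\<^bsub>C\<^esub> a = m \<cdot>\<^bsub>C\<^esub> b \<longrightarrow> a = b)"

text \<open>\<open>P\<close> is a product of \<open>E\<close> and \<open>A\<close>, and \<open>ev : P \<rightarrow> B\<close> is the evaluation of \<open>E = B\<^sup>A\<close>.\<close>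

definition is_exponential ::
  "('o, 'a) cat \<Rightarrow> 'o \<Rightarrow> 'o \<Rightarrow> 'o \<Rightarrow> 'o \<Rightarrow> 'a \<Rightarrow> 'a \<Rightarrow> 'a \<Rightarrow> bool" where
  "is_exponential C A B E P p q ev \<longleftrightarrow>
     is_binary_product C E A P p q \<and> ev \<in> hom_set C P B \<and>
     (\<forall>X Q p' q'. \<forall>h\<in>hom_set C Q B. is_binary_product C X A Q p' q' \<longrightarrow>
        (\<exists>!t. t \<in> hom_set C X E \<and>
           (\<exists>u\<in>hom_set C Q P. p \<cdot>\<^bsub>C\<^esub> u = t \<cdot>\<^bsub>C\<^esub> p' \<and> q \<cdot>\<^bsub>C\<^esub> u = q' \<and> ev \<cdot>\<^bsub>C\<^esub> u = h)))"

definition is_subobject_classifier :: "('o, 'a) cat \<Rightarrow> 'a \<Rightarrow> bool" where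
  "is_subobject_classifier C tt \<longleftrightarrow> tt \<in> Arr C \<and> is_terminal C (Dom C tt) \<and>
     (\<forall>m. is_mono C m \<longrightarrow>
        (\<exists>!\<theta>. \<theta> \<in> hom_set C (Cod C m) (Cod C tt) \<and>
              (\<exists>s\<in>hom_set C (Dom C m) (Dom C tt). is_pullback C \<theta> tt m s)))"

definition is_topos :: "('o, 'a) cat \<Rightarrow> bool" where
  "is_topos C \<longleftrightarrow> is_category C \<and>
     (\<exists>T. is_terminal C T) \<and>
     (\<forall>f\<in>Arr C. \<forall>g\<in>Arr C. Cod C f = Cod C g \<longrightarrow> (\<exists>p q. is_pullback C f g p q)) \<and>
     (\<forall>A\<in>Obj C. \<forall>B\<in>Obj C. \<exists>E P p q ev. is_exponential C A B E P p q ev) \<and>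
     (\<exists>tt. is_subobject_classifier C tt)"


section \<open>Smooth manifolds\<close>

text \<open>
  \<open>Rn n\<close>, with the topology inherited from the product topology of \<open>nat \<Rightarrow> real\<close>, is the Euclidean
  space of dimension \<open>n\<close>; this encoding lets the dimension vary.
\<close>

definition Rn :: "nat \<Rightarrow> (nat \<Rightarrow> real) set" where
  "Rn n = {x. \<forall>i\<ge>n. x i = 0}"

text \<open>\<open>Ck n U r f\<close>: on the open subset \<open>U\<close> of \<open>Rn n\<close>, all iterated partial derivatives of \<open>f\<close>
  of order at most \<open>r\<close> exist and are continuous.\<close>

primrec Ck :: "nat \<Rightarrow> (nat \<Rightarrow> real) set \<Rightarrow> nat \<Rightarrow> ((nat \<Rightarrow> real) \<Rightarrow> real) \<Rightarrow> bool" where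
  "Ck n U 0 f \<longleftrightarrow> continuous_on U f"
| "Ck n U (Suc r) f \<longleftrightarrow> continuous_on U f \<and>
     (\<forall>i<n. \<exists>g. (\<forall>x\<in>U. ((\<lambda>t. f (x(i := t))) has_real_derivative g x) (at (x i))) \<and> Ck n U r g)"

definition smooth_on ::
  "nat \<Rightarrow> (nat \<Rightarrow> real) set \<Rightarrow> nat \<Rightarrow> ((nat \<Rightarrow> real) \<Rightarrow> nat \<Rightarrow> real) \<Rightarrow> bool" where
  "smooth_on n U m f \<longleftrightarrow> (\<forall>j<m. \<forall>r. Ck n U r (\<lambda>x. f x j))"

text \<open>
  A manifold is second countable, so it has at most continuum many points; taking the points in
  \<open>nat \<Rightarrow> real\<close> (with an arbitrary topology) therefore loses no manifold up to diffeomorphism.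
  A chart is a pair of its domain and its coordinate map; atlases need not be maximal.
\<close>

record manifold =
  mtop :: "(nat \<Rightarrow> real) topology"
  mdim :: nat
  atlas :: "((nat \<Rightarrow> real) set \<times> ((nat \<Rightarrow> real) \<Rightarrow> nat \<Rightarrow> real)) set"

definition is_manifold :: "manifold \<Rightarrow> bool" where
  "is_manifold M \<longleftrightarrow> Hausdorff_space (mtop M) \<and> second_countable (mtop M) \<and>
     (\<Union>(U, \<phi>)\<in>atlas M. U) = topspace (mtop M) \<and>
     (\<forall>(U, \<phi>)\<in>atlas M. openin (mtop M) U \<and> openin (top_of_set (Rn (mdim M))) (\<phi> ` U) \<and>
        homeomorphic_map (subtopology (mtop M) U) (top_of_set (\<phi> ` U)) \<phi>) \<and>
     (\<forall>(U, \<phi>)\<in>atlas M. \<forall>(V, \<psi>)\<in>atlas M.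
        smooth_on (mdim M) (\<phi> ` (U \<inter> V)) (mdim M) (\<psi> \<circ> inv_into U \<phi>))"

type_synonym smooth_arrow = "manifold \<times> ((nat \<Rightarrow> real) \<Rightarrow> nat \<Rightarrow> real) \<times> manifold"

definition smooth_arrows :: "smooth_arrow set" where
  "smooth_arrows = {(M, f, N). is_manifold M \<and> is_manifold N \<and>
     f \<in> extensional (topspace (mtop M)) \<and> continuous_map (mtop M) (mtop N) f \<and>
     (\<forall>(U, \<phi>)\<in>atlas M. \<forall>(V, \<psi>)\<in>atlas N.
        smooth_on (mdim M) (\<phi> ` {x \<in> U. f x \<in> V}) (mdim N) (\<psi> \<circ> f \<circ> inv_into U \<phi>))}"

definition Mf :: "(manifold, smooth_arrow) cat" where
  "Mf = \<lparr>Obj = Collect is_manifold, Arr = smooth_arrows,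
         Dom = (\<lambda>(M, f, N). M), Cod = (\<lambda>(M, f, N). N),
         Ident = (\<lambda>M. (M, restrict id (topspace (mtop M)), M)),
         Comp = (\<lambda>(N', g, P) (M, f, N). (M, compose (topspace (mtop M)) g f, P))\<rparr>"

definition Euclid :: "nat \<Rightarrow> manifold" where
  "Euclid n = \<lparr>mtop = top_of_set (Rn n), mdim = n, atlas = {(Rn n, id)}\<rparr>"

definition open_submanifold :: "manifold \<Rightarrow> (nat \<Rightarrow> real) set \<Rightarrow> manifold" where
  "open_submanifold M U = \<lparr>mtop = subtopology (mtop M) U, mdim = mdim M,
     atlas = {(U \<inter> V, \<psi>) | V \<psi>. (V, \<psi>) \<in> atlas M}\<rparr>"

definition open_inclusion :: "manifold \<Rightarrow> (nat \<Rightarrow> real) set \<Rightarrow> smooth_arrow" where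
  "open_inclusion M U = (open_submanifold M U, restrict id U, M)"

definition chart_arrow :: "manifold \<Rightarrow> (nat \<Rightarrow> real) set \<Rightarrow> ((nat \<Rightarrow> real) \<Rightarrow> nat \<Rightarrow> real) \<Rightarrow> smooth_arrow" where
  "chart_arrow M U \<phi> = (open_submanifold M U, restrict \<phi> U, Euclid (mdim M))"

definition real_arrow :: "nat \<Rightarrow> ((nat \<Rightarrow> real) \<Rightarrow> real) \<Rightarrow> smooth_arrow" where
  "real_arrow n g = (Euclid n, restrict (\<lambda>x j. if j = 0 then g x else 0) (Rn n), Euclid 1)"


section \<open>Models of synthetic differential geometry containing the manifolds\<close>

text \<open>
  In what follows \<open>\<iota>\<close> is a functor from \<open>Mf\<close> to a category \<open>C\<close>.  The line object is the image of
  \<open>Euclid 1\<close>; its ring structure is the image of that of the real line.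
\<close>

definition line :: "(manifold, smooth_arrow, 'o, 'a) fctr \<Rightarrow> 'o" where
  "line \<iota> = fobj \<iota> (Euclid 1)"

definition coord :: "(manifold, smooth_arrow, 'o, 'a) fctr \<Rightarrow> nat \<Rightarrow> nat \<Rightarrow> 'a" where
  "coord \<iota> n i = farr \<iota> (real_arrow n (\<lambda>x. x i))"

definition tuple ::
  "('o, 'a) cat \<Rightarrow> (manifold, smooth_arrow, 'o, 'a) fctr \<Rightarrow> nat \<Rightarrow> 'o \<Rightarrow> (nat \<Rightarrow> 'a) \<Rightarrow> 'a" where
  "tuple C \<iota> n X a =
     (THE u. u \<in> hom_set C X (fobj \<iota> (Euclid n)) \<and> (\<forall>i<n. coord \<iota> n i \<cdot>\<^bsub>C\<^esub> u = a i))"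

text \<open>
  For generalized elements \<open>a 0, \<dots>, a (n - 1) : X \<rightarrow> R\<close> of the line object, \<open>op_at C \<iota> n g X a\<close> is
  the generalized element \<open>g (a 0, \<dots>, a (n - 1)) : X \<rightarrow> R\<close>.  It is used with polynomials \<open>g\<close> only.
\<close>

definition op_at ::
  "('o, 'a) cat \<Rightarrow> (manifold, smooth_arrow, 'o, 'a) fctr \<Rightarrow> nat \<Rightarrow> ((nat \<Rightarrow> real) \<Rightarrow> real) \<Rightarrow>
     'o \<Rightarrow> (nat \<Rightarrow> 'a) \<Rightarrow> 'a" where
  "op_at C \<iota> n g X a = farr \<iota> (real_arrow n g) \<cdot>\<^bsub>C\<^esub> tuple C \<iota> n X a"

definition zero_at :: "('o, 'a) cat \<Rightarrow> (manifold, smooth_arrow, 'o, 'a) fctr \<Rightarrow> 'o \<Rightarrow> 'a" where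
  "zero_at C \<iota> X = op_at C \<iota> 0 (\<lambda>_. 0) X undefined"

definition minus_at :: "('o, 'a) cat \<Rightarrow> (manifold, smooth_arrow, 'o, 'a) fctr \<Rightarrow> 'o \<Rightarrow> 'a \<Rightarrow> 'a \<Rightarrow> 'a" where
  "minus_at C \<iota> X a b = op_at C \<iota> 2 (\<lambda>x. x 0 - x 1) X (\<lambda>i. if i = 0 then a else b)"

text \<open>
  A Weil algebra of dimension \<open>m\<close>, presented by its structure constants
  \<open>e\<^sub>i e\<^sub>j = (\<Sum>l<m. \<gamma> i j l *\<^sub>R e\<^sub>l)\<close> with respect to a basis whose first member \<open>e\<^sub>0\<close> is the unit and
  whose other members span the nilpotent ideal.
\<close>

definition wmult :: "nat \<Rightarrow> (nat \<Rightarrow> nat \<Rightarrow> nat \<Rightarrow> real) \<Rightarrow> (nat \<Rightarrow> real) \<Rightarrow> (nat \<Rightarrow> real) \<Rightarrow> nat \<Rightarrow> real" where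
  "wmult m \<gamma> u v = (\<lambda>l. if l < m then \<Sum>i<m. \<Sum>j<m. u i * v j * \<gamma> i j l else 0)"

definition is_weil :: "nat \<Rightarrow> (nat \<Rightarrow> nat \<Rightarrow> nat \<Rightarrow> real) \<Rightarrow> bool" where
  "is_weil m \<gamma> \<longleftrightarrow> 0 < m \<and>
     (\<forall>u\<in>Rn m. \<forall>v\<in>Rn m. wmult m \<gamma> u v = wmult m \<gamma> v u) \<and>
     (\<forall>u\<in>Rn m. \<forall>v\<in>Rn m. \<forall>w\<in>Rn m. wmult m \<gamma> (wmult m \<gamma> u v) w = wmult m \<gamma> u (wmult m \<gamma> v w)) \<and>
     (\<forall>u\<in>Rn m. wmult m \<gamma> (\<lambda>i. if i = 0 then 1 else 0) u = u) \<and>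
     (\<forall>u\<in>Rn m. \<forall>v\<in>Rn m. u 0 = 0 \<longrightarrow> wmult m \<gamma> u v 0 = 0) \<and>
     (\<forall>u\<in>Rn m. u 0 = 0 \<longrightarrow> (\<exists>r. (wmult m \<gamma> u ^^ r) u = (\<lambda>_. 0)))"

text \<open>
  \<open>j : D \<rightarrow> R\<^sup>m\<close> is the object of algebra homomorphisms from the Weil algebra to the line \<open>R\<close>, such a
  homomorphism being given by its values on the basis.
\<close>

definition is_spectrum ::
  "('o, 'a) cat \<Rightarrow> (manifold, smooth_arrow, 'o, 'a) fctr \<Rightarrow> nat \<Rightarrow> (nat \<Rightarrow> nat \<Rightarrow> nat \<Rightarrow> real) \<Rightarrow> 'a \<Rightarrow> bool" where
  "is_spectrum C \<iota> m \<gamma> j \<longleftrightarrow> is_mono C j \<and> Cod C j = fobj \<iota> (Euclid m) \<and>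
     (\<forall>X\<in>Obj C. \<forall>b\<in>hom_set C X (fobj \<iota> (Euclid m)).
        (\<exists>u\<in>hom_set C X (Dom C j). j \<cdot>\<^bsub>C\<^esub> u = b) \<longleftrightarrow>
        farr \<iota> (real_arrow m (\<lambda>x. x 0)) \<cdot>\<^bsub>C\<^esub> b = farr \<iota> (real_arrow m (\<lambda>x. 1)) \<cdot>\<^bsub>C\<^esub> b \<and>
        (\<forall>i<m. \<forall>i'<m. farr \<iota> (real_arrow m (\<lambda>x. x i * x i')) \<cdot>\<^bsub>C\<^esub> b =
           farr \<iota> (real_arrow m (\<lambda>x. \<Sum>l<m. \<gamma> i i' l * x l)) \<cdot>\<^bsub>C\<^esub> b))"

text \<open>
  The general Kock-Lawvere axiom: for every Weil algebra \<open>W\<close> with spectrum \<open>D\<close>, the canonical map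
  \<open>R \<otimes> W \<rightarrow> R\<^sup>D\<close> is invertible.  In terms of generalized elements: every \<open>h : X \<times> D \<rightarrow> R\<close> is
  \<open>h (x, a) = (\<Sum>i<m. c i x * a i)\<close> for unique \<open>c 0, \<dots>, c (m - 1) : X \<rightarrow> R\<close>.
\<close>

definition kock_lawvere :: "('o, 'a) cat \<Rightarrow> (manifold, smooth_arrow, 'o, 'a) fctr \<Rightarrow> bool" where
  "kock_lawvere C \<iota> \<longleftrightarrow> (\<forall>m \<gamma> j. is_weil m \<gamma> \<longrightarrow> is_spectrum C \<iota> m \<gamma> j \<longrightarrow>
     (\<forall>X P p q. is_binary_product C X (Dom C j) P p q \<longrightarrow>
        (\<forall>h\<in>hom_set C P (line \<iota>). \<exists>!c. c \<in> {..<m} \<rightarrow>\<^sub>E hom_set C X (line \<iota>) \<and>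
           h = op_at C \<iota> (2 * m) (\<lambda>x. \<Sum>i<m. x i * x (m + i)) P
                 (\<lambda>i. if i < m then c i \<cdot>\<^bsub>C\<^esub> p else coord \<iota> m (i - m) \<cdot>\<^bsub>C\<^esub> j \<cdot>\<^bsub>C\<^esub> q))))"

definition sdg_model :: "('o, 'a) cat \<Rightarrow> (manifold, smooth_arrow, 'o, 'a) fctr \<Rightarrow> bool" where
  "sdg_model C \<iota> \<longleftrightarrow> is_topos C \<and>
     is_functor Mf C \<iota> \<and> fully_faithful Mf C \<iota> \<and>
     (\<forall>n. is_product C (fobj \<iota> (Euclid n)) {..<n} (coord \<iota> n) (\<lambda>_. line \<iota>)) \<and>
     kock_lawvere C \<iota>"

definition base_objects :: "(manifold, smooth_arrow, 'o, 'a) fctr \<Rightarrow> 'o set" where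
  "base_objects \<iota> = fobj \<iota> ` Collect is_manifold"


section \<open>Neighbourhoods of the diagonal\<close>

text \<open>
  For generalized elements \<open>b, b' : X \<rightarrow> R\<^sup>n\<close>, \<open>b'\<close> is a \<open>k\<close>th order neighbour of \<open>b\<close>.
\<close>

definition near_Rn ::
  "('o, 'a) cat \<Rightarrow> (manifold, smooth_arrow, 'o, 'a) fctr \<Rightarrow> nat \<Rightarrow> nat \<Rightarrow> 'o \<Rightarrow> 'a \<Rightarrow> 'a \<Rightarrow> bool" where
  "near_Rn C \<iota> k n X b b' \<longleftrightarrow> (\<forall>i\<in>{..k} \<rightarrow> {..<n}.
     op_at C \<iota> (Suc k) (\<lambda>x. \<Prod>j\<le>k. x j) X
       (\<lambda>j. minus_at C \<iota> X (coord \<iota> n (i j) \<cdot>\<^bsub>C\<^esub> b') (coord \<iota> n (i j) \<cdot>\<^bsub>C\<^esub> b)) = zero_at C \<iota> X)"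

text \<open>
  A subobject \<open>N\<close> of \<open>B \<times> B\<close>, where \<open>B = \<iota> M\<close>, is given by its jointly monic pair \<open>d, c : N \<rightarrow> B\<close> of
  projections.  It is the \<open>k\<close>th neighbourhood of the diagonal if a pair of elements of a chart domain
  belongs to \<open>N\<close> iff their coordinates are \<open>k\<close>-neighbours, and if \<open>N\<close> is covered by
  (the generalized elements of) its restrictions to the chart domains.  These conditions determine
  the subobject.
\<close>

definition is_nbhd ::
  "('o, 'a) cat \<Rightarrow> (manifold, smooth_arrow, 'o, 'a) fctr \<Rightarrow> nat \<Rightarrow> manifold \<Rightarrow> 'a \<Rightarrow> 'a \<Rightarrow> bool" where
  "is_nbhd C \<iota> k M d c \<longleftrightarrow>
     d \<in> hom_set C (Dom C d) (fobj \<iota> M) \<and> c \<in> hom_set C (Dom C d) (fobj \<iota> M) \<and>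
     (\<forall>X\<in>Obj C. \<forall>u\<in>hom_set C X (Dom C d). \<forall>v\<in>hom_set C X (Dom C d).
        d \<cdot>\<^bsub>C\<^esub> u = d \<cdot>\<^bsub>C\<^esub> v \<longrightarrow> c \<cdot>\<^bsub>C\<^esub> u = c \<cdot>\<^bsub>C\<^esub> v \<longrightarrow> u = v) \<and>
     (\<forall>(U, \<phi>)\<in>atlas M. \<forall>X\<in>Obj C.
        \<forall>b\<in>hom_set C X (fobj \<iota> (open_submanifold M U)).
        \<forall>b'\<in>hom_set C X (fobj \<iota> (open_submanifold M U)).
          (\<exists>u\<in>hom_set C X (Dom C d). d \<cdot>\<^bsub>C\<^esub> u = farr \<iota> (open_inclusion M U) \<cdot>\<^bsub>C\<^esub> b \<and>
                                  c \<cdot>\<^bsub>C\<^esub> u = farr \<iota> (open_inclusion M U) \<cdot>\<^bsub>C\<^esub> b') \<longleftrightarrow>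
          near_Rn C \<iota> k (mdim M) X (farr \<iota> (chart_arrow M U \<phi>) \<cdot>\<^bsub>C\<^esub> b)
                                  (farr \<iota> (chart_arrow M U \<phi>) \<cdot>\<^bsub>C\<^esub> b')) \<and>
     (\<forall>Z\<in>Obj C. \<forall>g\<in>hom_set C (Dom C d) Z. \<forall>h\<in>hom_set C (Dom C d) Z.
        (\<forall>(U, \<phi>)\<in>atlas M. \<forall>X\<in>Obj C. \<forall>u\<in>hom_set C X (Dom C d).
           (\<exists>b\<in>hom_set C X (fobj \<iota> (open_submanifold M U)).
            \<exists>b'\<in>hom_set C X (fobj \<iota> (open_submanifold M U)).
              d \<cdot>\<^bsub>C\<^esub> u = farr \<iota> (open_inclusion M U) \<cdot>\<^bsub>C\<^esub> b \<and>
              c \<cdot>\<^bsub>C\<^esub> u = farr \<iota> (open_inclusion M U) \<cdot>\<^bsub>C\<^esub> b') \<longrightarrow>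
           g \<cdot>\<^bsub>C\<^esub> u = h \<cdot>\<^bsub>C\<^esub> u) \<longrightarrow> g = h)"

text \<open>
  A choice, for each base object \<open>B\<close>, of the \<open>k\<close>th neighbourhood of the diagonal with its
  projections \<open>d B, c B\<close>, together with the two properties that the diagonal factors through it
  and that every arrow \<open>\<alpha>\<close> between base objects maps neighbours to neighbours.
\<close>

definition diagonal_nbhds ::
  "('o, 'a) cat \<Rightarrow> (manifold, smooth_arrow, 'o, 'a) fctr \<Rightarrow> nat \<Rightarrow> ('o \<Rightarrow> 'a) \<Rightarrow> ('o \<Rightarrow> 'a) \<Rightarrow> bool" where
  "diagonal_nbhds C \<iota> k d c \<longleftrightarrow>
     (\<forall>M. is_manifold M \<longrightarrow> is_nbhd C \<iota> k M (d (fobj \<iota> M)) (c (fobj \<iota> M))) \<and>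
     (\<forall>B\<in>base_objects \<iota>. \<exists>\<delta>\<in>hom_set C B (Dom C (d B)).
        d B \<cdot>\<^bsub>C\<^esub> \<delta> = Ident C B \<and> c B \<cdot>\<^bsub>C\<^esub> \<delta> = Ident C B) \<and>
     (\<forall>A\<in>base_objects \<iota>. \<forall>B\<in>base_objects \<iota>. \<forall>\<alpha>\<in>hom_set C A B.
        \<exists>\<alpha>'\<in>hom_set C (Dom C (d A)) (Dom C (d B)).
          d B \<cdot>\<^bsub>C\<^esub> \<alpha>' = \<alpha> \<cdot>\<^bsub>C\<^esub> d A \<and> c B \<cdot>\<^bsub>C\<^esub> \<alpha>' = \<alpha> \<cdot>\<^bsub>C\<^esub> c A)"


section \<open>Slices and the jet functors\<close>

text \<open>An arrow from \<open>x : X \<rightarrow> B\<close> to \<open>y : Y \<rightarrow> B\<close> in the slice over \<open>B\<close> is a triple \<open>(x, u, y)\<close>.\<close>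

definition slice :: "('o, 'a) cat \<Rightarrow> 'o \<Rightarrow> ('a, 'a \<times> 'a \<times> 'a) cat" where
  "slice C B = \<lparr>Obj = {x \<in> Arr C. Cod C x = B},
     Arr = {(x, u, y). x \<in> Arr C \<and> Cod C x = B \<and> y \<in> Arr C \<and> Cod C y = B \<and>
                       u \<in> hom_set C (Dom C x) (Dom C y) \<and> y \<cdot>\<^bsub>C\<^esub> u = x},
     Dom = (\<lambda>(x, u, y). x), Cod = (\<lambda>(x, u, y). y),
     Ident = (\<lambda>x. (x, Ident C (Dom C x), x)),
     Comp = (\<lambda>(y', w, z) (x, u, y). (x, w \<cdot>\<^bsub>C\<^esub> u, z))\<rparr>"

text \<open>
  For \<open>\<alpha> : A \<rightarrow> B\<close> and \<open>y : Y \<rightarrow> B\<close>, the chosen pull-back \<open>\<alpha>\<^sup>*(Y)\<close> has the projections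
  \<open>fst (pb \<alpha> y)\<close> to \<open>A\<close> and \<open>snd (pb \<alpha> y)\<close> to \<open>Y\<close>.
\<close>

definition pullback_choice :: "('o, 'a) cat \<Rightarrow> ('a \<Rightarrow> 'a \<Rightarrow> 'a \<times> 'a) \<Rightarrow> bool" where
  "pullback_choice C pb \<longleftrightarrow> (\<forall>\<alpha>\<in>Arr C. \<forall>y\<in>Arr C. Cod C \<alpha> = Cod C y \<longrightarrow>
     is_pullback C \<alpha> y (fst (pb \<alpha> y)) (snd (pb \<alpha> y)))"

definition pb_lift :: "('o, 'a) cat \<Rightarrow> ('a \<Rightarrow> 'a \<Rightarrow> 'a \<times> 'a) \<Rightarrow> 'a \<Rightarrow> 'a \<Rightarrow> 'a \<Rightarrow> 'a \<Rightarrow> 'a" where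
  "pb_lift C pb \<alpha> y a b = (THE h. h \<in> hom_set C (Dom C a) (Dom C (fst (pb \<alpha> y))) \<and>
     fst (pb \<alpha> y) \<cdot>\<^bsub>C\<^esub> h = a \<and> snd (pb \<alpha> y) \<cdot>\<^bsub>C\<^esub> h = b)"

definition pb_fctr ::
  "('o, 'a) cat \<Rightarrow> ('a \<Rightarrow> 'a \<Rightarrow> 'a \<times> 'a) \<Rightarrow> 'a \<Rightarrow> ('a, 'a \<times> 'a \<times> 'a, 'a, 'a \<times> 'a \<times> 'a) fctr" where
  "pb_fctr C pb \<alpha> = \<lparr>fobj = (\<lambda>y. fst (pb \<alpha> y)),
     farr = (\<lambda>(y, u, z). (fst (pb \<alpha> y),
                          pb_lift C pb \<alpha> z (fst (pb \<alpha> y)) (u \<cdot>\<^bsub>C\<^esub> snd (pb \<alpha> y)),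
                          fst (pb \<alpha> z)))\<rparr>"

text \<open>A choice of right adjoints \<open>\<Pi>\<^sub>f\<close> of the pull-back functors \<open>f\<^sup>*\<close>.\<close>

definition pi_choice ::
  "('o, 'a) cat \<Rightarrow> ('a \<Rightarrow> 'a \<Rightarrow> 'a \<times> 'a) \<Rightarrow>
     ('a \<Rightarrow> ('a, 'a \<times> 'a \<times> 'a, 'a, 'a \<times> 'a \<times> 'a) fctr) \<Rightarrow> bool" where
  "pi_choice C pb Pif \<longleftrightarrow> (\<forall>f\<in>Arr C.
     right_adjoint (slice C (Cod C f)) (slice C (Dom C f)) (pb_fctr C pb f) (Pif f))"

definition jet ::
  "('o, 'a) cat \<Rightarrow> ('a \<Rightarrow> 'a \<Rightarrow> 'a \<times> 'a) \<Rightarrow> ('a \<Rightarrow> ('a, 'a \<times> 'a \<times> 'a, 'a, 'a \<times> 'a \<times> 'a) fctr) \<Rightarrow>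
     ('o \<Rightarrow> 'a) \<Rightarrow> ('o \<Rightarrow> 'a) \<Rightarrow> 'o \<Rightarrow> ('a, 'a \<times> 'a \<times> 'a, 'a, 'a \<times> 'a \<times> 'a) fctr" where
  "jet C pb Pif d c B = fctr_comp (Pif (d B)) (pb_fctr C pb (c B))"


section \<open>The fibrewise dual of the codomain fibration\<close>

text \<open>
  \<open>pb_compare\<close> is the canonical arrow from the pull-back of \<open>z\<close> along \<open>\<beta> \<circ> \<alpha>\<close> to \<open>\<alpha>\<^sup>*(\<beta>\<^sup>*Z)\<close>.
\<close>

definition pb_compare :: "('o, 'a) cat \<Rightarrow> ('a \<Rightarrow> 'a \<Rightarrow> 'a \<times> 'a) \<Rightarrow> 'a \<Rightarrow> 'a \<Rightarrow> 'a \<Rightarrow> 'a" where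
  "pb_compare C pb \<alpha> \<beta> z = pb_lift C pb \<alpha> (fst (pb \<beta> z)) (fst (pb (\<beta> \<cdot>\<^bsub>C\<^esub> \<alpha>) z))
     (pb_lift C pb \<beta> z (\<alpha> \<cdot>\<^bsub>C\<^esub> fst (pb (\<beta> \<cdot>\<^bsub>C\<^esub> \<alpha>) z)) (snd (pb (\<beta> \<cdot>\<^bsub>C\<^esub> \<alpha>) z)))"

text \<open>
  A comorphism from \<open>x : X \<rightarrow> A\<close> to \<open>y : Y \<rightarrow> B\<close> over \<open>\<alpha> : A \<rightarrow> B\<close> is a tuple \<open>(x, \<alpha>, v, y)\<close> with
  \<open>v : \<alpha>\<^sup>*(Y) \<rightarrow> X\<close> over \<open>A\<close>.
\<close>

definition comorphisms ::
  "('o, 'a) cat \<Rightarrow> 'o set \<Rightarrow> ('a \<Rightarrow> 'a \<Rightarrow> 'a \<times> 'a) \<Rightarrow> ('a, 'a \<times> 'a \<times> 'a \<times> 'a) cat" where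
  "comorphisms C S pb = \<lparr>Obj = {x \<in> Arr C. Cod C x \<in> S},
     Arr = {(x, \<alpha>, v, y). x \<in> Arr C \<and> Cod C x \<in> S \<and> y \<in> Arr C \<and> Cod C y \<in> S \<and>
              \<alpha> \<in> hom_set C (Cod C x) (Cod C y) \<and>
              v \<in> hom_set C (Dom C (fst (pb \<alpha> y))) (Dom C x) \<and> x \<cdot>\<^bsub>C\<^esub> v = fst (pb \<alpha> y)},
     Dom = (\<lambda>(x, \<alpha>, v, y). x), Cod = (\<lambda>(x, \<alpha>, v, y). y),
     Ident = (\<lambda>x. (x, Ident C (Cod C x), snd (pb (Ident C (Cod C x)) x), x)),
     Comp = (\<lambda>(y', \<beta>, w, z) (x, \<alpha>, v, y). (x, \<beta> \<cdot>\<^bsub>C\<^esub> \<alpha>,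
        v \<cdot>\<^bsub>C\<^esub> fst (snd (farr (pb_fctr C pb \<alpha>) (fst (pb \<beta> z), w, y))) \<cdot>\<^bsub>C\<^esub> pb_compare C pb \<alpha> \<beta> z,
        z))\<rparr>"

definition base_proj :: "('o, 'a) cat \<Rightarrow> ('a, 'a \<times> 'a \<times> 'a \<times> 'a, 'o, 'a) fctr" where
  "base_proj C = \<lparr>fobj = Cod C, farr = (\<lambda>(x, \<alpha>, v, y). \<alpha>)\<rparr>"

definition fibre :: "('o, 'a) cat \<Rightarrow> ('p, 'b) cat \<Rightarrow> ('o, 'a, 'p, 'b) fctr \<Rightarrow> 'p \<Rightarrow> ('o, 'a) cat" where
  "fibre E S P B = E\<lparr>Obj := {x \<in> Obj E. fobj P x = B},
     Arr := {f \<in> Arr E. fobj P (Dom E f) = B \<and> fobj P (Cod E f) = B \<and> farr P f = Ident S B}\<rparr>"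

text \<open>
  The identification of the opposite of the slice over \<open>B\<close> with the fibre over \<open>B\<close>: an arrow
  \<open>u : X \<rightarrow> Y\<close> of the slice, read as an arrow from \<open>Y\<close> to \<open>X\<close> of its opposite, is the comorphism
  from \<open>Y\<close> to \<open>X\<close> given by the composite of \<open>id\<^sup>*(X) \<cong> X\<close> with \<open>u\<close>.
\<close>

definition fibre_incl ::
  "('o, 'a) cat \<Rightarrow> ('a \<Rightarrow> 'a \<Rightarrow> 'a \<times> 'a) \<Rightarrow> 'o \<Rightarrow> ('a, 'a \<times> 'a \<times> 'a, 'a, 'a \<times> 'a \<times> 'a \<times> 'a) fctr" where
  "fibre_incl C pb B = \<lparr>fobj = (\<lambda>x. x),
     farr = (\<lambda>(x, u, y). (y, Ident C B, u \<cdot>\<^bsub>C\<^esub> snd (pb (Ident C B) x), x))\<rparr>"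

end

theory Submission
  imports Defs
begin

text \<open>
  A comorphism from \<open>X\<close> over \<open>A\<close> to \<open>Y\<close> over \<open>B\<close> with base \<open>\<alpha>\<close> is a family of maps
  \<open>v\<^sub>a : Y\<^bsub>\<alpha>(a)\<^esub> \<rightarrow> X\<^sub>a\<close>.  It acts on jets by the formula: a jet \<open>s\<close> at \<open>\<alpha>(a)\<close> of sections of \<open>Y\<close> goes to the
  jet \<open>a' \<mapsto> v\<^bsub>a'\<^esub>(s(\<alpha>(a')))\<close> at \<open>a\<close> of sections of \<open>X\<close>.  This makes sense because \<open>\<alpha>\<close> sends the
  neighbours \<open>a'\<close> of \<open>a\<close> to neighbours of \<open>\<alpha>(a)\<close>, where \<open>s\<close> is defined.  The formula visibly preserves
  identities and composition, and for \<open>\<alpha> = id\<close> it is post-composition with \<open>v\<close>, which is the action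
  of the jet functor on the slice.

  The proof makes this argument about generalized elements literal.  An element of a pull-back is a
  pair (\<open>pair_arr\<close>, \<open>pair_eqI\<close>), and on pairs the composition of comorphisms, defined through
  comparison maps of iterated pull-backs, becomes \<open>v\<^sub>a(w\<^bsub>\<alpha>(a)\<^esub>(z))\<close> (\<open>app_comp_vertical\<close>).  The
  adjunction that defines \<open>\<Pi>\<^sub>d\<close> provides an evaluation of jets at neighbours
  (\<open>jet_evaluation_exists\<close>) such that a map into jets exists for every family of partial sections
  (\<open>jet_existence\<close>) and is determined by the values of its jets (\<open>jet_extensionality\<close>).  Existence gives
  the action of the formula above (\<open>jet_transport_exists\<close>), and extensionality reduces all functor laws
  to computations with values (\<open>jet_transport_comp\<close>, \<open>jet_transport_vertical\<close>).

  The maps on neighbourhoods induced by arrows of the base compose strictly since the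
  neighbourhoods are subobjects of \<open>B \<times> B\<close> (\<open>nbhd_map_comp\<close>).
\<close>

section \<open>Generalized elements of chosen pull-backs\<close>

locale generalized_elements =
  fixes C :: "('o, 'a) cat" (structure)
    and pb :: "'a \<Rightarrow> 'a \<Rightarrow> 'a \<times> 'a"
  assumes category: "is_category C"
    and pullbacks: "pullback_choice C pb"
begin

lemma obj_of_arr [simp]:
  assumes "f \<in> Arr C"
  shows "Dom C f \<in> Obj C" "Cod C f \<in> Obj C"
  using category assms unfolding is_category_def by blast+

lemma comp_arr [simp]:
  assumes "f \<in> Arr C" "g \<in> Arr C" "Cod C f = Dom C g"
  shows "g \<cdot> f \<in> Arr C" "Dom C (g \<cdot> f) = Dom C f" "Cod C (g \<cdot> f) = Cod C g"
proof -
  have "f \<in> hom_set C (Dom C f) (Dom C g)" "g \<in> hom_set C (Dom C g) (Cod C g)"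
    using assms by (simp_all add: hom_set_def)
  moreover have "Dom C f \<in> Obj C" "Dom C g \<in> Obj C" "Cod C g \<in> Obj C"
    using assms by simp_all
  ultimately have "g \<cdot> f \<in> hom_set C (Dom C f) (Cod C g)"
    using category unfolding is_category_def by blast
  then show "g \<cdot> f \<in> Arr C" "Dom C (g \<cdot> f) = Dom C f" "Cod C (g \<cdot> f) = Cod C g"
    by (simp_all add: hom_set_def)
qed

lemma comp_assoc [simp]:
  assumes "f \<in> Arr C" "g \<in> Arr C" "h \<in> Arr C" "Cod C f = Dom C g" "Cod C g = Dom C h"
  shows "(h \<cdot> g) \<cdot> f = h \<cdot> (g \<cdot> f)"
  using category assms unfolding is_category_def by blast

lemma ident_arr [simp]:
  assumes "X \<in> Obj C"
  shows "Ident C X \<in> Arr C" "Dom C (Ident C X) = X" "Cod C (Ident C X) = X"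
  using category assms unfolding is_category_def hom_set_def by blast+

lemma comp_ident [simp]:
  assumes "f \<in> Arr C"
  shows "Dom C f = X \<Longrightarrow> f \<cdot> Ident C X = f" "Cod C f = Y \<Longrightarrow> Ident C Y \<cdot> f = f"
  using category assms unfolding is_category_def by blast+

lemma pb_arr [simp]:
  assumes "\<alpha> \<in> Arr C" "y \<in> Arr C" "Cod C \<alpha> = Cod C y"
  shows "fst (pb \<alpha> y) \<in> Arr C" "Cod C (fst (pb \<alpha> y)) = Dom C \<alpha>"
    "snd (pb \<alpha> y) \<in> Arr C" "Dom C (snd (pb \<alpha> y)) = Dom C (fst (pb \<alpha> y))"
    "Cod C (snd (pb \<alpha> y)) = Dom C y"
    "y \<cdot> snd (pb \<alpha> y) = \<alpha> \<cdot> fst (pb \<alpha> y)"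
  using pullbacks assms unfolding pullback_choice_def is_pullback_def hom_set_def by auto

text \<open>
  The pairs \<open>(a, b)\<close> that are generalized elements of the pull-back of \<open>\<alpha>\<close> and \<open>y\<close>, with a common
  domain of variation.
\<close>

definition square :: "'a \<Rightarrow> 'a \<Rightarrow> 'a \<Rightarrow> 'a \<Rightarrow> bool" where
  "square \<alpha> y a b \<longleftrightarrow> \<alpha> \<in> Arr C \<and> y \<in> Arr C \<and> a \<in> Arr C \<and> b \<in> Arr C \<and> Cod C \<alpha> = Cod C y \<and>
     Dom C b = Dom C a \<and> Cod C a = Dom C \<alpha> \<and> Cod C b = Dom C y \<and> \<alpha> \<cdot> a = y \<cdot> b"

lemma squareD:
  assumes "square \<alpha> y a b"
  shows "a \<in> Arr C" "b \<in> Arr C" "Dom C b = Dom C a" "Cod C a = Dom C \<alpha>" "Cod C b = Dom C y"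
    "\<alpha> \<cdot> a = y \<cdot> b"
  using assms by (simp_all add: square_def)

abbreviation pair :: "'a \<Rightarrow> 'a \<Rightarrow> 'a \<Rightarrow> 'a \<Rightarrow> 'a" where
  "pair \<equiv> pb_lift C pb"

lemma pair_unique_existence:
  assumes "square \<alpha> y a b"
  shows "\<exists>!h. h \<in> hom_set C (Dom C a) (Dom C (fst (pb \<alpha> y))) \<and>
    fst (pb \<alpha> y) \<cdot> h = a \<and> snd (pb \<alpha> y) \<cdot> h = b"
proof -
  have "is_pullback C \<alpha> y (fst (pb \<alpha> y)) (snd (pb \<alpha> y))"
    using pullbacks assms unfolding pullback_choice_def square_def by blast
  moreover have "Dom C a \<in> Obj C" "a \<in> hom_set C (Dom C a) (Dom C \<alpha>)"
    "b \<in> hom_set C (Dom C a) (Dom C y)" "\<alpha> \<cdot> a = y \<cdot> b"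
    using assms by (auto simp: square_def hom_set_def)
  ultimately show ?thesis
    unfolding is_pullback_def by blast
qed

lemma pair_arr [simp]:
  assumes "square \<alpha> y a b"
  shows "pair \<alpha> y a b \<in> Arr C" "Dom C (pair \<alpha> y a b) = Dom C a"
    "Cod C (pair \<alpha> y a b) = Dom C (fst (pb \<alpha> y))"
    "fst (pb \<alpha> y) \<cdot> pair \<alpha> y a b = a" "snd (pb \<alpha> y) \<cdot> pair \<alpha> y a b = b"
  using theI' [OF pair_unique_existence [OF assms]] unfolding pb_lift_def hom_set_def by auto

lemma pair_eqI:
  assumes "square \<alpha> y a b" "h \<in> Arr C" "Cod C h = Dom C (fst (pb \<alpha> y))"
    "fst (pb \<alpha> y) \<cdot> h = a" "snd (pb \<alpha> y) \<cdot> h = b"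
  shows "pair \<alpha> y a b = h"
proof -
  have "Dom C a = Dom C h"
    using assms by (auto simp: square_def)
  then have "h \<in> hom_set C (Dom C a) (Dom C (fst (pb \<alpha> y)))"
    using assms by (simp add: hom_set_def)
  moreover have "pair \<alpha> y a b \<in> hom_set C (Dom C a) (Dom C (fst (pb \<alpha> y)))"
    using assms by (simp add: hom_set_def)
  ultimately show ?thesis
    using pair_unique_existence [OF assms(1)] pair_arr(4,5) [OF assms(1)] assms(4,5) by blast
qed

lemma square_comp:
  assumes "square \<alpha> y a b" "t \<in> Arr C" "Cod C t = Dom C a"
  shows "square \<alpha> y (a \<cdot> t) (b \<cdot> t)"
proof -
  have "\<alpha> \<cdot> (a \<cdot> t) = (\<alpha> \<cdot> a) \<cdot> t"
    using assms by (intro comp_assoc [symmetric]) (auto simp: square_def)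
  also have "\<dots> = (y \<cdot> b) \<cdot> t"
    using assms by (simp only: square_def)
  also have "\<dots> = y \<cdot> (b \<cdot> t)"
    using assms by (intro comp_assoc) (auto simp: square_def)
  finally show ?thesis
    using assms by (simp add: square_def)
qed

lemma pair_comp:
  assumes "square \<alpha> y a b" "t \<in> Arr C" "Cod C t = Dom C a"
  shows "pair \<alpha> y a b \<cdot> t = pair \<alpha> y (a \<cdot> t) (b \<cdot> t)"
proof (rule sym, rule pair_eqI [OF square_comp [OF assms]])
  have "fst (pb \<alpha> y) \<cdot> (pair \<alpha> y a b \<cdot> t) = (fst (pb \<alpha> y) \<cdot> pair \<alpha> y a b) \<cdot> t"
    using assms by (intro comp_assoc [symmetric]) (auto simp: square_def)
  then show "fst (pb \<alpha> y) \<cdot> (pair \<alpha> y a b \<cdot> t) = a \<cdot> t"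
    using assms(1) by simp
  have "snd (pb \<alpha> y) \<cdot> (pair \<alpha> y a b \<cdot> t) = (snd (pb \<alpha> y) \<cdot> pair \<alpha> y a b) \<cdot> t"
    using assms by (intro comp_assoc [symmetric]) (auto simp: square_def)
  then show "snd (pb \<alpha> y) \<cdot> (pair \<alpha> y a b \<cdot> t) = b \<cdot> t"
    using assms(1) by simp
qed (use assms in auto)

lemma square_proj:
  assumes "\<alpha> \<in> Arr C" "y \<in> Arr C" "Cod C \<alpha> = Cod C y"
  shows "square \<alpha> y (fst (pb \<alpha> y)) (snd (pb \<alpha> y))"
  using assms by (simp add: square_def)

lemma pair_proj:
  assumes "\<alpha> \<in> Arr C" "y \<in> Arr C" "Cod C \<alpha> = Cod C y"
  shows "pair \<alpha> y (fst (pb \<alpha> y)) (snd (pb \<alpha> y)) = Ident C (Dom C (fst (pb \<alpha> y)))"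
  using assms by (intro pair_eqI [OF square_proj]) auto

lemma pair_of_components:
  assumes "\<alpha> \<in> Arr C" "y \<in> Arr C" "Cod C \<alpha> = Cod C y"
    "q \<in> Arr C" "Cod C q = Dom C (fst (pb \<alpha> y))"
  shows "pair \<alpha> y (fst (pb \<alpha> y) \<cdot> q) (snd (pb \<alpha> y) \<cdot> q) = q"
  using assms by (intro pair_eqI [OF square_comp [OF square_proj]]) auto

text \<open>The value \<open>v\<^sub>a(b)\<close>, for an element \<open>a\<close> of the base and an element \<open>b\<close> of \<open>Y\<close> over \<open>\<alpha>(a)\<close>.\<close>

definition app :: "'a \<Rightarrow> 'a \<Rightarrow> 'a \<Rightarrow> 'a \<Rightarrow> 'a \<Rightarrow> 'a" where
  "app \<alpha> y v a b = v \<cdot> pair \<alpha> y a b"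

definition from_pb :: "'a \<Rightarrow> 'a \<Rightarrow> 'a \<Rightarrow> bool" where
  "from_pb \<alpha> y v \<longleftrightarrow> v \<in> Arr C \<and> Dom C v = Dom C (fst (pb \<alpha> y))"

lemma app_arr [simp]:
  assumes "from_pb \<alpha> y v" "square \<alpha> y a b"
  shows "app \<alpha> y v a b \<in> Arr C" "Dom C (app \<alpha> y v a b) = Dom C a"
    "Cod C (app \<alpha> y v a b) = Cod C v"
  using assms by (simp_all add: app_def from_pb_def)

lemma app_comp:
  assumes "from_pb \<alpha> y v" "square \<alpha> y a b" "t \<in> Arr C" "Cod C t = Dom C a"
  shows "app \<alpha> y v a b \<cdot> t = app \<alpha> y v (a \<cdot> t) (b \<cdot> t)"
  using assms by (simp add: app_def from_pb_def pair_comp)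

lemma over_app:
  assumes "from_pb \<alpha> y v" "square \<alpha> y a b" "x \<in> Arr C" "Cod C v = Dom C x"
    "x \<cdot> v = \<gamma> \<cdot> fst (pb \<alpha> y)" "\<gamma> \<in> Arr C" "Dom C \<gamma> = Dom C \<alpha>"
  shows "x \<cdot> app \<alpha> y v a b = \<gamma> \<cdot> a"
proof -
  have "x \<cdot> app \<alpha> y v a b = (x \<cdot> v) \<cdot> pair \<alpha> y a b"
    using assms(1-4) by (simp add: app_def from_pb_def)
  also have "\<dots> = \<gamma> \<cdot> fst (pb \<alpha> y) \<cdot> pair \<alpha> y a b"
    unfolding assms(5)
    using assms(1,2,6,7) by (intro comp_assoc) (auto simp: square_def)
  finally show ?thesis
    using assms(2) by simp
qed

subsection \<open>Comorphisms\<close>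

definition comorphism :: "'a \<Rightarrow> 'a \<Rightarrow> 'a \<Rightarrow> 'a \<Rightarrow> bool" where
  "comorphism x \<alpha> v y \<longleftrightarrow> x \<in> Arr C \<and> y \<in> Arr C \<and> \<alpha> \<in> hom_set C (Cod C x) (Cod C y) \<and>
     from_pb \<alpha> y v \<and> Cod C v = Dom C x \<and> x \<cdot> v = fst (pb \<alpha> y)"

lemma arr_comorphisms_iff:
  "(x, \<alpha>, v, y) \<in> Arr (comorphisms C S pb) \<longleftrightarrow>
     comorphism x \<alpha> v y \<and> Cod C x \<in> S \<and> Cod C y \<in> S"
  by (auto simp: comorphisms_def comorphism_def from_pb_def hom_set_def)

lemma comorphism_over_app:
  assumes "comorphism x \<alpha> v y" "square \<alpha> y a b"
  shows "x \<cdot> app \<alpha> y v a b = a"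
proof -
  have "x \<cdot> app \<alpha> y v a b = Ident C (Dom C \<alpha>) \<cdot> a"
    using assms by (intro over_app) (auto simp: comorphism_def hom_set_def)
  then show ?thesis
    using assms by (simp add: square_def)
qed

text \<open>
  The composite \<open>(\<beta> \<circ> \<alpha>)\<^sup>*Z \<rightarrow> \<alpha>\<^sup>*(\<beta>\<^sup>*Z) \<rightarrow> \<alpha>\<^sup>*Y \<rightarrow> X\<close> that underlies the composition of comorphisms.
\<close>

definition comp_vertical :: "'a \<Rightarrow> 'a \<Rightarrow> 'a \<Rightarrow> 'a \<Rightarrow> 'a \<Rightarrow> 'a \<Rightarrow> 'a" where
  "comp_vertical \<alpha> v y \<beta> w z =
     v \<cdot> fst (snd (farr (pb_fctr C pb \<alpha>) (fst (pb \<beta> z), w, y))) \<cdot> pb_compare C pb \<alpha> \<beta> z"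

lemma comp_comorphisms:
  "(y, \<beta>, w, z) \<cdot>\<^bsub>comorphisms C S pb\<^esub> (x, \<alpha>, v, y) =
     (x, \<beta> \<cdot> \<alpha>, comp_vertical \<alpha> v y \<beta> w z, z)"
  by (simp add: comorphisms_def comp_vertical_def)

lemma square_comp_base:
  assumes "\<alpha> \<in> Arr C" "\<beta> \<in> Arr C" "Cod C \<alpha> = Dom C \<beta>" "square (\<beta> \<cdot> \<alpha>) z a b"
  shows "square \<beta> z (\<alpha> \<cdot> a) b"
  using assms by (auto simp: square_def)

text \<open>
  It suffices to evaluate at the generic element \<open>(a, b)\<close> of the pull-back of \<open>Z\<close> along \<open>\<beta> \<circ> \<alpha>\<close>: there
  the comparison map is the iterated pair \<open>(a, (\<alpha>(a), b))\<close>.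
\<close>

lemma comp_vertical_generic:
  assumes f: "comorphism x \<alpha> v y" and g: "comorphism y \<beta> w z"
  defines "a \<equiv> fst (pb (\<beta> \<cdot> \<alpha>) z)" and "b \<equiv> snd (pb (\<beta> \<cdot> \<alpha>) z)"
  shows "square \<alpha> y a (app \<beta> z w (\<alpha> \<cdot> a) b)"
    and "comp_vertical \<alpha> v y \<beta> w z = app \<alpha> y v a (app \<beta> z w (\<alpha> \<cdot> a) b)"
proof -
  have arrs [simp]: "\<alpha> \<in> Arr C" "\<beta> \<in> Arr C" "x \<in> Arr C" "y \<in> Arr C" "z \<in> Arr C" "v \<in> Arr C" "w \<in> Arr C"
    "Dom C \<alpha> = Cod C x" "Cod C \<alpha> = Cod C y" "Dom C \<beta> = Cod C y" "Cod C \<beta> = Cod C z"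
    "Dom C v = Dom C (fst (pb \<alpha> y))" "Dom C w = Dom C (fst (pb \<beta> z))" "Cod C w = Dom C y"
    "Cod C v = Dom C x"
    using f g by (auto simp: comorphism_def hom_set_def from_pb_def)
  have wf: "from_pb \<beta> z w" "from_pb \<alpha> y v"
    using f g by (auto simp: comorphism_def)
  have yw: "y \<cdot> w = fst (pb \<beta> z)"
    using g by (simp add: comorphism_def)
  have sq: "square (\<beta> \<cdot> \<alpha>) z a b"
    unfolding a_def b_def by (rule square_proj) simp_all
  have a [simp]: "a \<in> Arr C" "Cod C a = Cod C x" and b [simp]: "b \<in> Arr C" "Dom C b = Dom C a" "Cod C b = Dom C z"
    using sq by (auto simp: square_def)
  have sq\<beta>: "square \<beta> z (\<alpha> \<cdot> a) b"
    by (rule square_comp_base [OF _ _ _ sq]) simp_all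
  define r where "r = pair \<beta> z (\<alpha> \<cdot> a) b"
  have r [simp]: "r \<in> Arr C" "Dom C r = Dom C a" "Cod C r = Dom C (fst (pb \<beta> z))"
    and fst_r: "fst (pb \<beta> z) \<cdot> r = \<alpha> \<cdot> a"
    using sq\<beta> by (simp_all add: r_def)
  have sqr: "square \<alpha> (fst (pb \<beta> z)) a r"
    by (simp add: square_def fst_r)
  have sqw: "square \<alpha> y (fst (pb \<alpha> (fst (pb \<beta> z)))) (w \<cdot> snd (pb \<alpha> (fst (pb \<beta> z))))"
  proof -
    have "y \<cdot> w \<cdot> snd (pb \<alpha> (fst (pb \<beta> z))) = (y \<cdot> w) \<cdot> snd (pb \<alpha> (fst (pb \<beta> z)))"
      by (intro comp_assoc [symmetric]) simp_all
    then show ?thesis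
      by (simp add: square_def yw)
  qed
  show sqapp: "square \<alpha> y a (app \<beta> z w (\<alpha> \<cdot> a) b)"
    using comorphism_over_app [OF g sq\<beta>] sq\<beta> wf by (simp add: square_def)
  have "comp_vertical \<alpha> v y \<beta> w z =
      v \<cdot> pair \<alpha> y (fst (pb \<alpha> (fst (pb \<beta> z)))) (w \<cdot> snd (pb \<alpha> (fst (pb \<beta> z)))) \<cdot>
        pair \<alpha> (fst (pb \<beta> z)) a r"
    by (simp add: comp_vertical_def pb_fctr_def pb_compare_def a_def b_def r_def)
  also have "\<dots> = v \<cdot> pair \<alpha> y a (w \<cdot> r)"
    using sqr by (simp add: pair_comp [OF sqw])
  finally show "comp_vertical \<alpha> v y \<beta> w z = app \<alpha> y v a (app \<beta> z w (\<alpha> \<cdot> a) b)"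
    by (simp add: app_def r_def)
qed

text \<open>
  Hence the composite of comorphisms, whose definition passes through \<open>\<alpha>\<^sup>*(\<beta>\<^sup>*Z)\<close>, is on elements the
  formula \<open>v\<^sub>a(w\<^bsub>\<alpha>(a)\<^esub>(b))\<close>; the coherence isomorphisms disappear from all later computations.
\<close>

lemma app_comp_vertical:
  assumes f: "comorphism x \<alpha> v y" and g: "comorphism y \<beta> w z" and sq: "square (\<beta> \<cdot> \<alpha>) z a b"
  shows "app (\<beta> \<cdot> \<alpha>) z (comp_vertical \<alpha> v y \<beta> w z) a b = app \<alpha> y v a (app \<beta> z w (\<alpha> \<cdot> a) b)"
proof -
  have typing [simp]: "\<alpha> \<in> Arr C" "\<beta> \<in> Arr C" "z \<in> Arr C" "Cod C \<alpha> = Dom C \<beta>"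
    "Cod C \<beta> = Cod C z" "from_pb \<alpha> y v" "from_pb \<beta> z w"
    using f g by (auto simp: comorphism_def hom_set_def)
  define a0 b0 t where "a0 = fst (pb (\<beta> \<cdot> \<alpha>) z)" and "b0 = snd (pb (\<beta> \<cdot> \<alpha>) z)"
    and "t = pair (\<beta> \<cdot> \<alpha>) z a b"
  have t [simp]: "t \<in> Arr C" "Cod C t = Dom C a0" "a0 \<cdot> t = a" "b0 \<cdot> t = b"
    using sq by (simp_all add: t_def a0_def b0_def)
  have a0 [simp]: "a0 \<in> Arr C" "Cod C a0 = Dom C \<alpha>" "square (\<beta> \<cdot> \<alpha>) z a0 b0"
    using square_proj [of "\<beta> \<cdot> \<alpha>" z] by (simp_all add: a0_def b0_def)
  have sq0: "square \<beta> z (\<alpha> \<cdot> a0) b0"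
    by (rule square_comp_base) simp_all
  note gen = comp_vertical_generic [OF f g, folded a0_def b0_def]
  have "app (\<beta> \<cdot> \<alpha>) z (comp_vertical \<alpha> v y \<beta> w z) a b = app \<alpha> y v a0 (app \<beta> z w (\<alpha> \<cdot> a0) b0) \<cdot> t"
    unfolding gen(2) by (simp add: app_def t_def)
  also have "\<dots> = app \<alpha> y v a (app \<beta> z w (\<alpha> \<cdot> a0) b0 \<cdot> t)"
    using gen(1) by (simp add: app_comp)
  also have "app \<beta> z w (\<alpha> \<cdot> a0) b0 \<cdot> t = app \<beta> z w (\<alpha> \<cdot> a) b"
    using sq0 by (simp add: app_comp)
  finally show ?thesis .
qed

lemma comorphism_comp:
  assumes f: "comorphism x \<alpha> v y" and g: "comorphism y \<beta> w z"
  shows "comorphism x (\<beta> \<cdot> \<alpha>) (comp_vertical \<alpha> v y \<beta> w z) z"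
proof -
  have typing [simp]: "\<alpha> \<in> Arr C" "\<beta> \<in> Arr C" "z \<in> Arr C" "x \<in> Arr C" "Cod C \<alpha> = Dom C \<beta>"
    "Dom C \<alpha> = Cod C x" "Cod C \<beta> = Cod C z" "from_pb \<alpha> y v" "from_pb \<beta> z w" "Cod C v = Dom C x"
    using f g by (auto simp: comorphism_def hom_set_def)
  note gen = comp_vertical_generic [OF f g]
  show ?thesis
    using gen(1) comorphism_over_app [OF f gen(1)]
    by (simp add: comorphism_def hom_set_def from_pb_def [of "\<beta> \<cdot> \<alpha>"] gen(2))
qed

lemma comorphism_ident:
  assumes "x \<in> Arr C"
  shows "comorphism x (Ident C (Cod C x)) (snd (pb (Ident C (Cod C x)) x)) x"
  using assms by (simp add: comorphism_def hom_set_def from_pb_def)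

text \<open>
  The element \<open>(x, id)\<close> of \<open>id\<^sup>*X\<close> is inverse to the projection \<open>id\<^sup>*X \<rightarrow> X\<close>.  Invertibility of this
  projection is what identifies the fibres of the fibrewise dual with the opposites of the slices.
\<close>

lemma pb_ident_iso:
  assumes "x \<in> Arr C"
  defines "i \<equiv> Ident C (Cod C x)"
  shows "square i x x (Ident C (Dom C x))"
    and "pair i x x (Ident C (Dom C x)) \<cdot> snd (pb i x) = Ident C (Dom C (fst (pb i x)))"
proof -
  show *: "square i x x (Ident C (Dom C x))"
    using assms(1) by (simp add: square_def i_def)
  show "pair i x x (Ident C (Dom C x)) \<cdot> snd (pb i x) = Ident C (Dom C (fst (pb i x)))"
    using assms(1) pair_proj [of i x] by (simp add: pair_comp [OF * [unfolded i_def]] i_def)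
qed

lemma comorphism_vertical:
  assumes "x \<in> Arr C" "y \<in> Arr C" "Cod C x = Cod C y" "u \<in> hom_set C (Dom C x) (Dom C y)" "y \<cdot> u = x"
  shows "comorphism y (Ident C (Cod C y)) (u \<cdot> snd (pb (Ident C (Cod C y)) x)) x"
proof -
  have i: "Ident C (Cod C y) \<in> Arr C" "Cod C (Ident C (Cod C y)) = Cod C x"
    using assms by simp_all
  have "y \<cdot> (u \<cdot> snd (pb (Ident C (Cod C y)) x)) = (y \<cdot> u) \<cdot> snd (pb (Ident C (Cod C y)) x)"
    using assms(1,2,4) i by (intro comp_assoc [symmetric]) (simp_all add: hom_set_def)
  also have "\<dots> = x \<cdot> snd (pb (Ident C (Cod C y)) x)"
    by (simp only: assms(5))
  also have "\<dots> = Ident C (Cod C y) \<cdot> fst (pb (Ident C (Cod C y)) x)"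
    using assms(1) i by (intro pb_arr) simp_all
  also have "\<dots> = fst (pb (Ident C (Cod C y)) x)"
    using assms(1,2) i by (intro comp_ident) simp_all
  finally show ?thesis
    using assms(1,2,4) i by (simp add: comorphism_def from_pb_def hom_set_def)
qed

lemma app_vertical:
  assumes "square (Ident C B) x a b" "u \<in> Arr C" "Dom C u = Dom C x" "B \<in> Obj C" "x \<in> Arr C" "Cod C x = B"
  shows "app (Ident C B) x (u \<cdot> snd (pb (Ident C B) x)) a b = u \<cdot> b"
  using assms by (simp add: app_def)

end

section \<open>Jets as partial sections\<close>

text \<open>
  \<open>ev y\<close> is the evaluation \<open>(n, s) \<mapsto> s(c n)\<close> of a jet \<open>s\<close> of sections of \<open>y\<close> at a neighbour \<open>n\<close>
  of its base point \<open>d n\<close>.  The four clauses record what the adjunction between pull-back along \<open>d\<close>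
  and \<open>\<Pi>\<^sub>d\<close> says about the composite functor \<open>J = \<Pi>\<^sub>d \<circ> c\<^sup>*\<close>: jets over \<open>p\<close> are the same as partial
  sections \<open>h\<close> on neighbourhoods, and \<open>J\<close> acts on an arrow by post-composition.
\<close>

definition (in generalized_elements) jet_evaluation ::
  "'o \<Rightarrow> 'a \<Rightarrow> 'a \<Rightarrow> ('a, 'a \<times> 'a \<times> 'a, 'a, 'a \<times> 'a \<times> 'a) fctr \<Rightarrow> ('a \<Rightarrow> 'a) \<Rightarrow> bool" where
  "jet_evaluation B d c J ev \<longleftrightarrow>
     (\<forall>y\<in>Arr C. Cod C y = B \<longrightarrow> fobj J y \<in> Arr C \<and> Cod C (fobj J y) = B) \<and>
     (\<forall>y\<in>Arr C. Cod C y = B \<longrightarrow> from_pb d (fobj J y) (ev y) \<and> Cod C (ev y) = Dom C y \<and>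
        y \<cdot> ev y = c \<cdot> fst (pb d (fobj J y))) \<and>
     (\<forall>y\<in>Arr C. Cod C y = B \<longrightarrow> (\<forall>p\<in>Arr C. \<forall>h. Cod C p = B \<longrightarrow> from_pb d p h \<longrightarrow> Cod C h = Dom C y \<longrightarrow>
        y \<cdot> h = c \<cdot> fst (pb d p) \<longrightarrow>
        (\<exists>!g. g \<in> hom_set C (Dom C p) (Dom C (fobj J y)) \<and> fobj J y \<cdot> g = p \<and>
           app d (fobj J y) (ev y) (fst (pb d p)) (g \<cdot> snd (pb d p)) = h))) \<and>
     (\<forall>x u y. (x, u, y) \<in> Arr (slice C B) \<longrightarrow>
        (\<exists>u'\<in>hom_set C (Dom C (fobj J x)) (Dom C (fobj J y)).
           farr J (x, u, y) = (fobj J x, u', fobj J y) \<and> fobj J y \<cdot> u' = fobj J x \<and>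
           app d (fobj J y) (ev y) (fst (pb d (fobj J x))) (u' \<cdot> snd (pb d (fobj J x))) = u \<cdot> ev x))"

locale jet_bundles = generalized_elements C pb
  for C :: "('o, 'a) cat" (structure) and pb +
  fixes S :: "'o set"
    and d c :: "'o \<Rightarrow> 'a"
    and JB :: "'o \<Rightarrow> ('a, 'a \<times> 'a \<times> 'a, 'a, 'a \<times> 'a \<times> 'a) fctr"
    and ev :: "'a \<Rightarrow> 'a"
  assumes nbhd_arr [simp]: "B \<in> S \<Longrightarrow> d B \<in> Arr C" "B \<in> S \<Longrightarrow> Cod C (d B) = B"
      "B \<in> S \<Longrightarrow> c B \<in> Arr C" "B \<in> S \<Longrightarrow> Dom C (c B) = Dom C (d B)" "B \<in> S \<Longrightarrow> Cod C (c B) = B"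
    and nbhd_joint_mono: "\<lbrakk>B \<in> S; u \<in> Arr C; v \<in> Arr C; Dom C u = Dom C v; Cod C u = Dom C (d B);
      Cod C v = Dom C (d B); d B \<cdot> u = d B \<cdot> v; c B \<cdot> u = c B \<cdot> v\<rbrakk> \<Longrightarrow> u = v"
    and nbhd_functorial: "\<lbrakk>A \<in> S; B \<in> S; \<alpha> \<in> hom_set C A B\<rbrakk> \<Longrightarrow>
      \<exists>\<alpha>'\<in>hom_set C (Dom C (d A)) (Dom C (d B)). d B \<cdot> \<alpha>' = \<alpha> \<cdot> d A \<and> c B \<cdot> \<alpha>' = \<alpha> \<cdot> c A"
    and jet_evaluation: "B \<in> S \<Longrightarrow> jet_evaluation B (d B) (c B) (JB B) ev"
begin

lemma jet_obj:
  assumes "y \<in> Arr C" "Cod C y \<in> S"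
  shows "fobj (JB (Cod C y)) y \<in> Arr C \<and> Cod C (fobj (JB (Cod C y)) y) = Cod C y"
  using jet_evaluation [OF assms(2)] assms(1) unfolding jet_evaluation_def by blast

lemma ev_arr:
  assumes "y \<in> Arr C" "Cod C y \<in> S"
  shows "from_pb (d (Cod C y)) (fobj (JB (Cod C y)) y) (ev y) \<and> Cod C (ev y) = Dom C y \<and>
    y \<cdot> ev y = c (Cod C y) \<cdot> fst (pb (d (Cod C y)) (fobj (JB (Cod C y)) y))"
  using jet_evaluation [OF assms(2)] assms(1) unfolding jet_evaluation_def by blast

lemma ev_universal:
  assumes "y \<in> Arr C" "Cod C y \<in> S" "p \<in> Arr C" "Cod C p = Cod C y" "from_pb (d (Cod C y)) p h"
    "Cod C h = Dom C y" "y \<cdot> h = c (Cod C y) \<cdot> fst (pb (d (Cod C y)) p)"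
  shows "\<exists>!g. g \<in> hom_set C (Dom C p) (Dom C (fobj (JB (Cod C y)) y)) \<and> fobj (JB (Cod C y)) y \<cdot> g = p \<and>
    app (d (Cod C y)) (fobj (JB (Cod C y)) y) (ev y)
      (fst (pb (d (Cod C y)) p)) (g \<cdot> snd (pb (d (Cod C y)) p)) = h"
proof -
  note jet_evaluation [OF assms(2), unfolded jet_evaluation_def, THEN conjunct2, THEN conjunct2, THEN conjunct1]
  from bspec [OF this assms(1), rule_format, OF refl assms(3-7)] show ?thesis .
qed

lemma jet_arr:
  assumes "B \<in> S" "(x, u, y) \<in> Arr (slice C B)"
  shows "\<exists>u'\<in>hom_set C (Dom C (fobj (JB B) x)) (Dom C (fobj (JB B) y)).
    farr (JB B) (x, u, y) = (fobj (JB B) x, u', fobj (JB B) y) \<and>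
    fobj (JB B) y \<cdot> u' = fobj (JB B) x \<and>
    app (d B) (fobj (JB B) y) (ev y) (fst (pb (d B) (fobj (JB B) x)))
      (u' \<cdot> snd (pb (d B) (fobj (JB B) x))) = u \<cdot> ev x"
  using jet_evaluation [OF assms(1)] assms(2) unfolding jet_evaluation_def by blast

definition jets :: "'a \<Rightarrow> 'a" where
  "jets y = fobj (JB (Cod C y)) y"

definition eval_jet :: "'a \<Rightarrow> 'a \<Rightarrow> 'a \<Rightarrow> 'a" where
  "eval_jet y n s = app (d (Cod C y)) (jets y) (ev y) n s"

definition over :: "'a \<Rightarrow> bool" where
  "over y \<longleftrightarrow> y \<in> Arr C \<and> Cod C y \<in> S"

lemma over_simps [simp]:
  assumes "over y"
  shows "y \<in> Arr C" "Cod C y \<in> S" "jets y \<in> Arr C" "Cod C (jets y) = Cod C y"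
    "from_pb (d (Cod C y)) (jets y) (ev y)" "Cod C (ev y) = Dom C y"
  using assms jet_obj [of y] ev_arr [of y] by (auto simp: over_def jets_def)

lemma over_jets [simp]: "over y \<Longrightarrow> over (jets y)"
  by (simp add: over_def [of "jets y"])

lemma eval_jet_arr [simp]:
  assumes "over y" "square (d (Cod C y)) (jets y) n s"
  shows "eval_jet y n s \<in> Arr C" "Dom C (eval_jet y n s) = Dom C n" "Cod C (eval_jet y n s) = Dom C y"
    "y \<cdot> eval_jet y n s = c (Cod C y) \<cdot> n"
proof -
  show "eval_jet y n s \<in> Arr C" "Dom C (eval_jet y n s) = Dom C n" "Cod C (eval_jet y n s) = Dom C y"
    using assms by (simp_all add: eval_jet_def)
  show "y \<cdot> eval_jet y n s = c (Cod C y) \<cdot> n"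
    unfolding eval_jet_def using assms ev_arr [of y]
    by (intro over_app) (auto simp: jets_def)
qed

lemma eval_jet_comp:
  assumes "over y" "square (d (Cod C y)) (jets y) n s" "t \<in> Arr C" "Cod C t = Dom C n"
  shows "eval_jet y n s \<cdot> t = eval_jet y (n \<cdot> t) (s \<cdot> t)"
  using assms by (simp add: eval_jet_def app_comp)

lemma square_jet_comp:
  assumes "over y" "p \<in> Arr C" "g \<in> Arr C" "Dom C g = Dom C p" "Cod C g = Dom C (jets y)" "jets y \<cdot> g = p"
    "square (d (Cod C y)) p n q"
  shows "square (d (Cod C y)) (jets y) n (g \<cdot> q)"
proof -
  have "jets y \<cdot> (g \<cdot> q) = (jets y \<cdot> g) \<cdot> q"
    using assms by (intro comp_assoc [symmetric]) (auto simp: square_def)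
  also have "\<dots> = p \<cdot> q"
    by (simp only: assms)
  finally have "jets y \<cdot> (g \<cdot> q) = p \<cdot> q" .
  moreover have "Cod C p = Cod C y"
    using comp_arr(3) [of g "jets y"] assms(1,3,5,6) by simp
  ultimately show ?thesis
    using assms(1,3,4,5) squareD [OF assms(7)] by (simp add: square_def)
qed

text \<open>
  The transpose across the adjunction, in elements: a family of partial sections
  \<open>n \<mapsto> h(n, q)\<close>, indexed by \<open>q\<close>, is the family of values of a map \<open>g\<close> into the jets.  The adjunction
  yields the equation at the generic \<open>(n, q)\<close>, and every other pair is a pull-back of that one.
\<close>

lemma jet_existence:
  assumes y: "over y" and p: "p \<in> Arr C" "Cod C p = Cod C y"
    and h: "from_pb (d (Cod C y)) p h" "Cod C h = Dom C y"
      "y \<cdot> h = c (Cod C y) \<cdot> fst (pb (d (Cod C y)) p)"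
  obtains g where "g \<in> Arr C" "Dom C g = Dom C p" "Cod C g = Dom C (jets y)" "jets y \<cdot> g = p"
    "\<And>n q. square (d (Cod C y)) p n q \<Longrightarrow> eval_jet y n (g \<cdot> q) = app (d (Cod C y)) p h n q"
proof -
  let ?d = "d (Cod C y)"
  let ?n = "fst (pb ?d p)" and ?q = "snd (pb ?d p)"
  obtain g where g: "g \<in> Arr C" "Dom C g = Dom C p" "Cod C g = Dom C (jets y)" "jets y \<cdot> g = p"
    "eval_jet y ?n (g \<cdot> ?q) = h"
    using ev_universal [of y p h] y p h
    unfolding jets_def hom_set_def eval_jet_def by auto
  have sq0: "square ?d p ?n ?q"
    using y p by (intro square_proj) simp_all
  have "eval_jet y n (g \<cdot> q) = app ?d p h n q" if sq: "square ?d p n q" for n q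
  proof -
    let ?t = "pair ?d p n q"
    have "app ?d p h n q = eval_jet y ?n (g \<cdot> ?q) \<cdot> ?t"
      by (simp add: app_def g)
    also have "\<dots> = eval_jet y (?n \<cdot> ?t) ((g \<cdot> ?q) \<cdot> ?t)"
      using square_jet_comp [OF y p(1) g(1-4) sq0] sq y p
      by (intro eval_jet_comp) simp_all
    finally show ?thesis
      using sq y p g(1-3) by simp
  qed
  then show thesis
    using that g(1-4) by blast
qed

text \<open>
  The values at the generic pair \<open>(n, q)\<close> are the transposes, and maps with equal transposes are equal.
\<close>

lemma jet_extensionality:
  assumes y: "over y" and p: "p \<in> Arr C"
    and g: "g \<in> Arr C" "Dom C g = Dom C p" "Cod C g = Dom C (jets y)" "jets y \<cdot> g = p"
    and g': "g' \<in> Arr C" "Dom C g' = Dom C p" "Cod C g' = Dom C (jets y)" "jets y \<cdot> g' = p"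
    and eq: "\<And>n q. square (d (Cod C y)) p n q \<Longrightarrow> eval_jet y n (g \<cdot> q) = eval_jet y n (g' \<cdot> q)"
  shows "g = g'"
proof -
  let ?d = "d (Cod C y)"
  let ?n = "fst (pb ?d p)" and ?q = "snd (pb ?d p)"
  have pC: "Cod C p = Cod C y"
    using y g by auto
  have sq0: "square ?d p ?n ?q"
    using y p pC by (intro square_proj) simp_all
  define h where "h = eval_jet y ?n (g \<cdot> ?q)"
  have h': "eval_jet y ?n (g' \<cdot> ?q) = h"
    using eq [OF sq0] by (simp add: h_def)
  have sq: "square ?d (jets y) ?n (g \<cdot> ?q)"
    by (rule square_jet_comp [OF y p g sq0])
  have "\<exists>!g. g \<in> hom_set C (Dom C p) (Dom C (jets y)) \<and> jets y \<cdot> g = p \<and> eval_jet y ?n (g \<cdot> ?q) = h"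
    unfolding jets_def eval_jet_def
    using y p pC eval_jet_arr [OF y sq]
    by (intro ev_universal) (simp_all add: h_def from_pb_def)
  moreover have "g \<in> hom_set C (Dom C p) (Dom C (jets y))" "g' \<in> hom_set C (Dom C p) (Dom C (jets y))"
    using g g' by (simp_all add: hom_set_def)
  ultimately show ?thesis
    using h' g(4) g'(4) unfolding h_def by blast
qed

subsection \<open>The action of the base on neighbours\<close>

text \<open>
  The restriction of \<open>\<alpha> \<times> \<alpha>\<close> to the neighbourhoods of the diagonals.  The description by \<open>THE\<close> is
  legitimate because the two projections of a neighbourhood are jointly monic, and for the same
  reason these restrictions compose strictly.
\<close>

definition nbhd_map :: "'a \<Rightarrow> 'a" where
  "nbhd_map \<alpha> = (THE \<alpha>'. \<alpha>' \<in> hom_set C (Dom C (d (Dom C \<alpha>))) (Dom C (d (Cod C \<alpha>))) \<and>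
     d (Cod C \<alpha>) \<cdot> \<alpha>' = \<alpha> \<cdot> d (Dom C \<alpha>) \<and> c (Cod C \<alpha>) \<cdot> \<alpha>' = \<alpha> \<cdot> c (Dom C \<alpha>))"

lemma nbhd_map_unique_existence:
  assumes "\<alpha> \<in> Arr C" "Dom C \<alpha> \<in> S" "Cod C \<alpha> \<in> S"
  shows "\<exists>!\<alpha>'. \<alpha>' \<in> hom_set C (Dom C (d (Dom C \<alpha>))) (Dom C (d (Cod C \<alpha>))) \<and>
     d (Cod C \<alpha>) \<cdot> \<alpha>' = \<alpha> \<cdot> d (Dom C \<alpha>) \<and> c (Cod C \<alpha>) \<cdot> \<alpha>' = \<alpha> \<cdot> c (Dom C \<alpha>)" (is "\<exists>!u. ?P u")
proof (rule ex_ex1I)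
  show "\<exists>u. ?P u"
    using nbhd_functorial [of "Dom C \<alpha>" "Cod C \<alpha>" \<alpha>] assms by (auto simp: hom_set_def)
  show "u = v" if "?P u" "?P v" for u v
    using that assms by - (rule nbhd_joint_mono [of "Cod C \<alpha>"]; simp add: hom_set_def)
qed

lemma nbhd_map_arr [simp]:
  assumes "\<alpha> \<in> Arr C" "Dom C \<alpha> \<in> S" "Cod C \<alpha> \<in> S"
  shows "nbhd_map \<alpha> \<in> Arr C" "Dom C (nbhd_map \<alpha>) = Dom C (d (Dom C \<alpha>))" "Cod C (nbhd_map \<alpha>) = Dom C (d (Cod C \<alpha>))"
    "d (Cod C \<alpha>) \<cdot> nbhd_map \<alpha> = \<alpha> \<cdot> d (Dom C \<alpha>)" "c (Cod C \<alpha>) \<cdot> nbhd_map \<alpha> = \<alpha> \<cdot> c (Dom C \<alpha>)"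
  using theI' [OF nbhd_map_unique_existence [OF assms]] unfolding nbhd_map_def hom_set_def by auto

lemma nbhd_map_apply:
  assumes "\<alpha> \<in> Arr C" "Dom C \<alpha> = A" "Cod C \<alpha> = B" "A \<in> S" "B \<in> S" "n \<in> Arr C" "Cod C n = Dom C (d A)"
  shows "d B \<cdot> (nbhd_map \<alpha> \<cdot> n) = \<alpha> \<cdot> (d A \<cdot> n)" "c B \<cdot> (nbhd_map \<alpha> \<cdot> n) = \<alpha> \<cdot> (c A \<cdot> n)"
proof -
  have "d B \<cdot> (nbhd_map \<alpha> \<cdot> n) = (d B \<cdot> nbhd_map \<alpha>) \<cdot> n" "c B \<cdot> (nbhd_map \<alpha> \<cdot> n) = (c B \<cdot> nbhd_map \<alpha>) \<cdot> n"
    using assms by (auto intro!: comp_assoc [symmetric] simp del: comp_assoc)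
  moreover have "d B \<cdot> nbhd_map \<alpha> = \<alpha> \<cdot> d A" "c B \<cdot> nbhd_map \<alpha> = \<alpha> \<cdot> c A"
    using assms nbhd_map_arr(4,5) [of \<alpha>] by auto
  ultimately show "d B \<cdot> (nbhd_map \<alpha> \<cdot> n) = \<alpha> \<cdot> (d A \<cdot> n)" "c B \<cdot> (nbhd_map \<alpha> \<cdot> n) = \<alpha> \<cdot> (c A \<cdot> n)"
    using assms by (simp_all del: nbhd_map_arr)
qed

lemma nbhd_map_eqI:
  assumes "\<alpha> \<in> Arr C" "Dom C \<alpha> \<in> S" "Cod C \<alpha> \<in> S"
    "u \<in> Arr C" "Dom C u = Dom C (d (Dom C \<alpha>))" "Cod C u = Dom C (d (Cod C \<alpha>))"
    "d (Cod C \<alpha>) \<cdot> u = \<alpha> \<cdot> d (Dom C \<alpha>)" "c (Cod C \<alpha>) \<cdot> u = \<alpha> \<cdot> c (Dom C \<alpha>)"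
  shows "nbhd_map \<alpha> = u"
  using assms by - (rule nbhd_joint_mono [of "Cod C \<alpha>"]; simp)

lemma nbhd_map_ident [simp]:
  assumes "B \<in> S"
  shows "nbhd_map (Ident C B) = Ident C (Dom C (d B))"
proof -
  have "B \<in> Obj C"
    using obj_of_arr(2) [of "d B"] assms by simp
  then show ?thesis
    using assms by (intro nbhd_map_eqI) simp_all
qed

lemma nbhd_map_comp:
  assumes "\<alpha> \<in> Arr C" "\<beta> \<in> Arr C" "Cod C \<alpha> = Dom C \<beta>" "Dom C \<alpha> \<in> S" "Cod C \<alpha> \<in> S" "Cod C \<beta> \<in> S"
  shows "nbhd_map (\<beta> \<cdot> \<alpha>) = nbhd_map \<beta> \<cdot> nbhd_map \<alpha>"
  using assms nbhd_map_apply [of \<beta> "Dom C \<beta>" "Cod C \<beta>" "nbhd_map \<alpha>"] nbhd_map_arr [of \<alpha>]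
  by (intro nbhd_map_eqI) simp_all


section \<open>The jet functor on comorphisms\<close>

text \<open>The formula \<open>v\<^bsub>a'\<^esub>(s(\<alpha>(a')))\<close> for a neighbour \<open>n = (a, a')\<close> and a jet \<open>s\<close> at \<open>\<alpha>(a)\<close>.\<close>

definition jet_value :: "'a \<Rightarrow> 'a \<Rightarrow> 'a \<Rightarrow> 'a \<Rightarrow> 'a \<Rightarrow> 'a \<Rightarrow> 'a" where
  "jet_value x \<alpha> v y n s = app \<alpha> y v (c (Cod C x) \<cdot> n) (eval_jet y (nbhd_map \<alpha> \<cdot> n) s)"

text \<open>
  \<open>w\<close> is the comorphism of jets induced by \<open>v\<close>.  It is specified by the values of the jets \<open>w\<^sub>a(s)\<close>,
  where \<open>n = (a, a')\<close> ranges over the neighbours of \<open>a\<close>; since \<open>n\<close> carries its base point \<open>a = d n\<close>, the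
  pairs \<open>(n, s)\<close> are the elements of the pull-back of \<open>J Y\<close> along \<open>\<alpha> \<circ> d\<close>.
\<close>

definition jet_transport :: "'a \<Rightarrow> 'a \<Rightarrow> 'a \<Rightarrow> 'a \<Rightarrow> 'a \<Rightarrow> bool" where
  "jet_transport x \<alpha> v y w \<longleftrightarrow> comorphism (jets x) \<alpha> w (jets y) \<and>
     (\<forall>n s. square (\<alpha> \<cdot> d (Cod C x)) (jets y) n s \<longrightarrow>
        eval_jet x n (app \<alpha> (jets y) w (d (Cod C x) \<cdot> n) s) = jet_value x \<alpha> v y n s)"

context
  fixes x \<alpha> v y
  assumes f: "comorphism x \<alpha> v y" and x [simp]: "over x" and y [simp]: "over y"
begin

lemma base_arr [simp]: "\<alpha> \<in> Arr C" "Dom C \<alpha> = Cod C x" "Cod C \<alpha> = Cod C y" "from_pb \<alpha> y v" "Cod C v = Dom C x"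
  using f by (auto simp: comorphism_def hom_set_def)

lemma jet_squareD:
  assumes "square (\<alpha> \<cdot> d (Cod C x)) (jets y) n s"
  shows "n \<in> Arr C" "Cod C n = Dom C (d (Cod C x))" "s \<in> Arr C" "Cod C s = Dom C (jets y)" "Dom C s = Dom C n"
    "\<alpha> \<cdot> (d (Cod C x) \<cdot> n) = jets y \<cdot> s"
proof -
  show *: "n \<in> Arr C" "Cod C n = Dom C (d (Cod C x))" "s \<in> Arr C" "Cod C s = Dom C (jets y)" "Dom C s = Dom C n"
    using squareD [OF assms] by simp_all
  show "\<alpha> \<cdot> (d (Cod C x) \<cdot> n) = jets y \<cdot> s"
    using squareD(6) [OF assms] * by simp
qed

lemma jet_squareI:
  assumes "n \<in> Arr C" "Cod C n = Dom C (d (Cod C x))" "s \<in> Arr C" "Cod C s = Dom C (jets y)" "Dom C s = Dom C n"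
    "\<alpha> \<cdot> (d (Cod C x) \<cdot> n) = jets y \<cdot> s"
  shows "square (\<alpha> \<cdot> d (Cod C x)) (jets y) n s"
  using assms by (simp add: square_def)

lemma jet_squares:
  assumes "square (\<alpha> \<cdot> d (Cod C x)) (jets y) n s"
  shows "square \<alpha> (jets y) (d (Cod C x) \<cdot> n) s"
    and "square (d (Cod C y)) (jets y) (nbhd_map \<alpha> \<cdot> n) s"
    and "square \<alpha> y (c (Cod C x) \<cdot> n) (eval_jet y (nbhd_map \<alpha> \<cdot> n) s)"
proof -
  note [simp] = jet_squareD [OF assms]
  have nb: "d (Cod C y) \<cdot> (nbhd_map \<alpha> \<cdot> n) = \<alpha> \<cdot> (d (Cod C x) \<cdot> n)"
    "c (Cod C y) \<cdot> (nbhd_map \<alpha> \<cdot> n) = \<alpha> \<cdot> (c (Cod C x) \<cdot> n)"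
    by (intro nbhd_map_apply; simp)+
  show "square \<alpha> (jets y) (d (Cod C x) \<cdot> n) s"
    by (simp add: square_def)
  show *: "square (d (Cod C y)) (jets y) (nbhd_map \<alpha> \<cdot> n) s"
    using nb by (simp add: square_def)
  show "square \<alpha> y (c (Cod C x) \<cdot> n) (eval_jet y (nbhd_map \<alpha> \<cdot> n) s)"
    using nb eval_jet_arr [OF y *] by (simp add: square_def)
qed

lemma jet_value_arr:
  assumes "square (\<alpha> \<cdot> d (Cod C x)) (jets y) n s"
  shows "jet_value x \<alpha> v y n s \<in> Arr C" "Dom C (jet_value x \<alpha> v y n s) = Dom C n"
    "Cod C (jet_value x \<alpha> v y n s) = Dom C x"
    "x \<cdot> jet_value x \<alpha> v y n s = c (Cod C x) \<cdot> n"
  using jet_squares(3) [OF assms] jet_squareD [OF assms] comorphism_over_app [OF f]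
  by (simp_all add: jet_value_def)

lemma jet_value_comp:
  assumes sq: "square (\<alpha> \<cdot> d (Cod C x)) (jets y) n s" and t: "t \<in> Arr C" "Cod C t = Dom C n"
  shows "jet_value x \<alpha> v y n s \<cdot> t = jet_value x \<alpha> v y (n \<cdot> t) (s \<cdot> t)"
  using jet_squares(2,3) [OF sq] jet_squareD [OF sq] t
  by (simp add: jet_value_def app_comp eval_jet_comp)

text \<open>
  An element \<open>q\<close> of \<open>\<alpha>\<^sup>*(J Y)\<close> together with a neighbour \<open>n\<close> of its base point amounts to a pair \<open>(n, s)\<close>,
  since the base point can be recovered from \<open>n\<close>.
\<close>

lemma jet_square_of_pb:
  assumes "square (d (Cod C x)) (fst (pb \<alpha> (jets y))) n q"
  shows "square (\<alpha> \<cdot> d (Cod C x)) (jets y) n (snd (pb \<alpha> (jets y)) \<cdot> q)"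
    "pair \<alpha> (jets y) (d (Cod C x) \<cdot> n) (snd (pb \<alpha> (jets y)) \<cdot> q) = q"
proof -
  note q [simp] = squareD(1-5) [OF assms]
  have pq: "d (Cod C x) \<cdot> n = fst (pb \<alpha> (jets y)) \<cdot> q"
    using squareD(6) [OF assms] .
  have "jets y \<cdot> (snd (pb \<alpha> (jets y)) \<cdot> q) = (jets y \<cdot> snd (pb \<alpha> (jets y))) \<cdot> q"
    by (intro comp_assoc [symmetric]) simp_all
  also have "\<dots> = \<alpha> \<cdot> (d (Cod C x) \<cdot> n)"
    by (simp add: pq)
  finally show "square (\<alpha> \<cdot> d (Cod C x)) (jets y) n (snd (pb \<alpha> (jets y)) \<cdot> q)"
    by (intro jet_squareI) simp_all
  show "pair \<alpha> (jets y) (d (Cod C x) \<cdot> n) (snd (pb \<alpha> (jets y)) \<cdot> q) = q"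
    unfolding pq by (rule pair_of_components) simp_all
qed

lemma pb_square_of_jet:
  assumes "square (\<alpha> \<cdot> d (Cod C x)) (jets y) n s"
  shows "square (d (Cod C x)) (fst (pb \<alpha> (jets y))) n (pair \<alpha> (jets y) (d (Cod C x) \<cdot> n) s)"
  using jet_squareD [OF assms] jet_squares(1) [OF assms] by (simp add: square_def)

lemma comorphism_jets_arr:
  assumes "comorphism (jets x) \<alpha> w (jets y)"
  shows "w \<in> Arr C" "Dom C w = Dom C (fst (pb \<alpha> (jets y)))" "Cod C w = Dom C (jets x)"
    "jets x \<cdot> w = fst (pb \<alpha> (jets y))"
  using assms by (auto simp: comorphism_def from_pb_def)

text \<open>
  A comorphism into the jets of \<open>X\<close> is known once all values of its jets are known: this is
  extensionality of jets over the generic element of \<open>\<alpha>\<^sup>*(J Y)\<close>.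
\<close>

lemma jet_comorphism_extensionality:
  assumes w: "comorphism (jets x) \<alpha> w (jets y)" and w': "comorphism (jets x) \<alpha> w' (jets y)"
    and eq: "\<And>n s. square (\<alpha> \<cdot> d (Cod C x)) (jets y) n s \<Longrightarrow>
      eval_jet x n (app \<alpha> (jets y) w (d (Cod C x) \<cdot> n) s) = eval_jet x n (app \<alpha> (jets y) w' (d (Cod C x) \<cdot> n) s)"
  shows "w = w'"
proof (rule jet_extensionality [OF x, of "fst (pb \<alpha> (jets y))"])
  fix n q assume *: "square (d (Cod C x)) (fst (pb \<alpha> (jets y))) n q"
  show "eval_jet x n (w \<cdot> q) = eval_jet x n (w' \<cdot> q)"
    using eq [OF jet_square_of_pb(1) [OF *]] by (simp add: app_def jet_square_of_pb(2) [OF *])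
qed (use comorphism_jets_arr [OF w] comorphism_jets_arr [OF w'] in simp_all)

text \<open>
  The values \<open>v\<^bsub>a'\<^esub>(s(\<alpha>(a')))\<close> at the generic element of \<open>d\<^sup>*(\<alpha>\<^sup>*(J Y))\<close> form a family of partial sections of
  \<open>X\<close>; its transpose is the comorphism of jets, and naturality of both sides in the element extends the
  equation from the generic element to all elements.
\<close>

lemma jet_transport_exists: "\<exists>w. jet_transport x \<alpha> v y w"
proof -
  let ?d = "d (Cod C x)"
  define p s0 where "p = fst (pb \<alpha> (jets y))" and "s0 = snd (pb \<alpha> (jets y))"
  define n0 q0 where "n0 = fst (pb ?d p)" and "q0 = snd (pb ?d p)"
  have p [simp]: "p \<in> Arr C" "Cod C p = Cod C x" and s0: "s0 \<in> Arr C" "Dom C s0 = Dom C p"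
    by (simp_all add: p_def s0_def)
  have sq0: "square ?d p n0 q0"
    unfolding n0_def q0_def by (rule square_proj) simp_all
  note jsq0 = jet_square_of_pb(1) [folded p_def s0_def, OF sq0]
  define h where "h = jet_value x \<alpha> v y n0 (s0 \<cdot> q0)"
  obtain g where g: "g \<in> Arr C" "Dom C g = Dom C p" "Cod C g = Dom C (jets x)" "jets x \<cdot> g = p"
    and val: "\<And>n q. square ?d p n q \<Longrightarrow> eval_jet x n (g \<cdot> q) = app ?d p h n q"
  proof (rule jet_existence [OF x p(1,2), of h])
    show "from_pb ?d p h" "Cod C h = Dom C x" "x \<cdot> h = c (Cod C x) \<cdot> fst (pb ?d p)"
      using jet_value_arr [OF jsq0] by (simp_all add: from_pb_def h_def n0_def [symmetric])
  qed blast
  have "eval_jet x n (app \<alpha> (jets y) g (?d \<cdot> n) s) = jet_value x \<alpha> v y n s"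
    if sq: "square (\<alpha> \<cdot> ?d) (jets y) n s" for n s
  proof -
    define q where "q = pair \<alpha> (jets y) (?d \<cdot> n) s"
    have sqq: "square ?d p n q"
      unfolding q_def p_def by (rule pb_square_of_jet [OF sq])
    let ?t = "pair ?d p n q"
    have t: "n0 \<cdot> ?t = n" "q0 \<cdot> ?t = q" "?t \<in> Arr C" "Cod C ?t = Dom C n0"
      unfolding n0_def q0_def using sqq by simp_all
    have "s0 \<cdot> q = s"
      unfolding s0_def q_def using jet_squares(1) [OF sq] by simp
    moreover have "(s0 \<cdot> q0) \<cdot> ?t = s0 \<cdot> (q0 \<cdot> ?t)"
      using s0 squareD(1-5) [OF sq0] t(3,4) by (intro comp_assoc) simp_all
    ultimately have "h \<cdot> ?t = jet_value x \<alpha> v y n s"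
      unfolding h_def using jet_value_comp [OF jsq0 t(3,4)] t by simp
    then show ?thesis
      using val [OF sqq] by (simp add: app_def q_def)
  qed
  moreover have "comorphism (jets x) \<alpha> g (jets y)"
    using g by (simp add: comorphism_def hom_set_def from_pb_def p_def)
  ultimately show ?thesis
    unfolding jet_transport_def by blast
qed

lemma jet_transport_unique:
  assumes "jet_transport x \<alpha> v y w" "jet_transport x \<alpha> v y w'"
  shows "w = w'"
proof (rule jet_comorphism_extensionality)
  show "comorphism (jets x) \<alpha> w (jets y)" "comorphism (jets x) \<alpha> w' (jets y)"
    using assms by (simp_all add: jet_transport_def)
  show "eval_jet x n (app \<alpha> (jets y) w (d (Cod C x) \<cdot> n) s) = eval_jet x n (app \<alpha> (jets y) w' (d (Cod C x) \<cdot> n) s)"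
    if "square (\<alpha> \<cdot> d (Cod C x)) (jets y) n s" for n s
    using assms that by (simp add: jet_transport_def)
qed

end

declare base_arr [simp del]

definition jet_comor :: "'a \<times> 'a \<times> 'a \<times> 'a \<Rightarrow> 'a \<times> 'a \<times> 'a \<times> 'a" where
  "jet_comor = (\<lambda>(x, \<alpha>, v, y). (jets x, \<alpha>, THE w. jet_transport x \<alpha> v y w, jets y))"

lemma jet_comor_eqI:
  assumes "comorphism x \<alpha> v y" "over x" "over y" "jet_transport x \<alpha> v y w"
  shows "jet_comor (x, \<alpha>, v, y) = (jets x, \<alpha>, w, jets y)"
  using jet_transport_unique [OF assms(1-3)] assms(4) by (auto simp: jet_comor_def)

lemma jet_comor_cases:
  assumes "comorphism x \<alpha> v y" "over x" "over y"
  obtains w where "jet_transport x \<alpha> v y w" "jet_comor (x, \<alpha>, v, y) = (jets x, \<alpha>, w, jets y)"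
  using jet_transport_exists [OF assms] jet_comor_eqI [OF assms] by blast

text \<open>
  By both routes the value at \<open>n = (a, a')\<close> of the transport of \<open>s\<close> is
  \<open>v\<^bsub>a'\<^esub>(w\<^bsub>\<alpha>(a')\<^esub>(s(\<beta>(\<alpha>(a')))))\<close>.
\<close>

lemma jet_transport_comp:
  assumes f: "comorphism x \<alpha> v y" and g: "comorphism y \<beta> w z"
    and o: "over x" "over y" "over z"
    and f': "jet_transport x \<alpha> v y v'" and g': "jet_transport y \<beta> w z w'"
  shows "jet_transport x (\<beta> \<cdot> \<alpha>) (comp_vertical \<alpha> v y \<beta> w z) z (comp_vertical \<alpha> v' (jets y) \<beta> w' (jets z))"
proof -
  note [simp] = base_arr [OF f o(1,2)] base_arr [OF g o(2,3)] o
  have cf: "comorphism (jets x) \<alpha> v' (jets y)" and cg: "comorphism (jets y) \<beta> w' (jets z)"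
    using f' g' by (auto simp: jet_transport_def)
  have fg: "comorphism x (\<beta> \<cdot> \<alpha>) (comp_vertical \<alpha> v y \<beta> w z) z"
    by (rule comorphism_comp [OF f g])
  have "eval_jet x n (app (\<beta> \<cdot> \<alpha>) (jets z) (comp_vertical \<alpha> v' (jets y) \<beta> w' (jets z)) (d (Cod C x) \<cdot> n) s) =
      jet_value x (\<beta> \<cdot> \<alpha>) (comp_vertical \<alpha> v y \<beta> w z) z n s"
    if sq: "square ((\<beta> \<cdot> \<alpha>) \<cdot> d (Cod C x)) (jets z) n s" for n s
  proof -
    let ?a = "d (Cod C x) \<cdot> n" and ?n' = "nbhd_map \<alpha> \<cdot> n"
    note n [simp] = jet_squareD(1-5) [OF fg o(1,3) sq]
    note sqs = jet_squares [OF fg o(1,3) sq]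
    have nb: "d (Cod C y) \<cdot> ?n' = \<alpha> \<cdot> ?a" "c (Cod C y) \<cdot> ?n' = \<alpha> \<cdot> (c (Cod C x) \<cdot> n)"
      by (intro nbhd_map_apply; simp)+
    have "\<beta> \<cdot> (d (Cod C y) \<cdot> ?n') = jets z \<cdot> s"
      unfolding nb(1) using jet_squareD(6) [OF fg o(1,3) sq] by simp
    then have sqg: "square (\<beta> \<cdot> d (Cod C y)) (jets z) ?n' s"
      by (intro jet_squareI [OF g o(2,3)]) simp_all
    have sqb: "square \<beta> (jets z) (\<alpha> \<cdot> ?a) s"
      using jet_squares(1) [OF g o(2,3) sqg] by (simp add: nb)
    define s' where "s' = app \<beta> (jets z) w' (\<alpha> \<cdot> ?a) s"
    have w': "from_pb \<beta> (jets z) w'" "Cod C w' = Dom C (jets y)"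
      using cg unfolding comorphism_def by blast+
    have s': "s' \<in> Arr C" "Dom C s' = Dom C n" "Cod C s' = Dom C (jets y)" "jets y \<cdot> s' = \<alpha> \<cdot> ?a"
      using w' sqb comorphism_over_app [OF cg sqb] by (simp_all add: s'_def)
    have sqf: "square (\<alpha> \<cdot> d (Cod C x)) (jets y) n s'"
      using s' by (intro jet_squareI [OF f o(1,2)]) simp_all
    have "eval_jet x n (app (\<beta> \<cdot> \<alpha>) (jets z) (comp_vertical \<alpha> v' (jets y) \<beta> w' (jets z)) ?a s) =
        eval_jet x n (app \<alpha> (jets y) v' ?a s')"
      unfolding s'_def using app_comp_vertical [OF cf cg sqs(1)] by simp
    also have "\<dots> = app \<alpha> y v (c (Cod C x) \<cdot> n) (eval_jet y ?n' s')"
      using f' sqf by (simp add: jet_transport_def jet_value_def)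
    also have "eval_jet y ?n' s' = jet_value y \<beta> w z ?n' s"
      using g' sqg unfolding jet_transport_def s'_def nb(1) [symmetric] by blast
    also have "\<dots> = app \<beta> z w (\<alpha> \<cdot> (c (Cod C x) \<cdot> n)) (eval_jet z (nbhd_map \<beta> \<cdot> ?n') s)"
      by (simp only: jet_value_def nb)
    also have "nbhd_map \<beta> \<cdot> ?n' = nbhd_map (\<beta> \<cdot> \<alpha>) \<cdot> n"
      by (simp add: nbhd_map_comp)
    also have "app \<alpha> y v (c (Cod C x) \<cdot> n) (app \<beta> z w (\<alpha> \<cdot> (c (Cod C x) \<cdot> n)) (eval_jet z (nbhd_map (\<beta> \<cdot> \<alpha>) \<cdot> n) s)) =
        jet_value x (\<beta> \<cdot> \<alpha>) (comp_vertical \<alpha> v y \<beta> w z) z n s"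
      unfolding jet_value_def using app_comp_vertical [OF f g sqs(3)] by simp
    finally show ?thesis .
  qed
  then show ?thesis
    unfolding jet_transport_def using comorphism_comp [OF cf cg] by blast
qed


text \<open>
  Over an identity the neighbour \<open>n\<close> is not moved, so the transport of a jet is post-composition, which
  is how \<open>J\<close> acts on the slice.  The projections \<open>snd (pb id x)\<close> only identify \<open>id\<^sup>*X\<close> with \<open>X\<close>.  The case
  \<open>u = id\<close>, \<open>u' = id\<close> gives the preservation of identities.
\<close>

lemma jet_transport_vertical:
  assumes o: "over x" "over y" "Cod C x = Cod C y"
    and u: "u \<in> hom_set C (Dom C x) (Dom C y)" "y \<cdot> u = x"
    and u': "u' \<in> hom_set C (Dom C (jets x)) (Dom C (jets y))" "jets y \<cdot> u' = jets x"
    and val: "\<And>n s. square (d (Cod C y)) (jets x) n s \<Longrightarrow> eval_jet y n (u' \<cdot> s) = u \<cdot> eval_jet x n s"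
  shows "jet_transport y (Ident C (Cod C y)) (u \<cdot> snd (pb (Ident C (Cod C y)) x)) x
           (u' \<cdot> snd (pb (Ident C (Cod C y)) (jets x)))"
proof -
  let ?i = "Ident C (Cod C y)"
  have B [simp]: "Cod C y \<in> Obj C"
    using o by simp
  have f: "comorphism y ?i (u \<cdot> snd (pb ?i x)) x"
    using o(1,2) u by (intro comorphism_vertical) (simp_all add: o(3))
  have f': "comorphism (jets y) ?i (u' \<cdot> snd (pb ?i (jets x))) (jets x)"
    using comorphism_vertical [of "jets x" "jets y" u'] o(1,2) u' by (simp add: o(3))
  have "eval_jet y n (app ?i (jets x) (u' \<cdot> snd (pb ?i (jets x))) (d (Cod C y) \<cdot> n) s) =
      jet_value y ?i (u \<cdot> snd (pb ?i x)) x n s"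
    if sq: "square (?i \<cdot> d (Cod C y)) (jets x) n s" for n s
  proof -
    note sqs = jet_squares [OF f o(2,1) sq]
    have n: "n \<in> Arr C" "Cod C n = Dom C (d (Cod C y))"
      using jet_squareD [OF f o(2,1) sq] by simp_all
    have sqx: "square (d (Cod C y)) (jets x) n s"
      using sq o(1,2) by simp
    have "app ?i (jets x) (u' \<cdot> snd (pb ?i (jets x))) (d (Cod C y) \<cdot> n) s = u' \<cdot> s"
      using sqs(1) u' o(1,2) by (intro app_vertical) (simp_all add: hom_set_def o(3))
    moreover have "jet_value y ?i (u \<cdot> snd (pb ?i x)) x n s = u \<cdot> eval_jet x n s"
      unfolding jet_value_def using app_vertical [OF sqs(3)] u n o(1,2) by (simp add: hom_set_def o(3))
    ultimately show ?thesis
      using val [OF sqx] by (simp only:)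
  qed
  then show ?thesis
    unfolding jet_transport_def using f' by blast
qed

subsection \<open>Functoriality and restriction to the fibres\<close>

definition jet_fctr :: "('a, 'a \<times> 'a \<times> 'a \<times> 'a, 'a, 'a \<times> 'a \<times> 'a \<times> 'a) fctr" where
  "jet_fctr = \<lparr>fobj = jets, farr = jet_comor\<rparr>"

lemma arr_comorphisms_over:
  "(x, \<alpha>, v, y) \<in> Arr (comorphisms C S pb) \<longleftrightarrow> comorphism x \<alpha> v y \<and> over x \<and> over y"
  by (auto simp: arr_comorphisms_iff over_def comorphism_def simp del: over_simps)

lemma jet_comor_ident:
  assumes o: "over x"
  shows "jet_comor (x, Ident C (Cod C x), snd (pb (Ident C (Cod C x)) x), x) =
    (jets x, Ident C (Cod C x), snd (pb (Ident C (Cod C x)) (jets x)), jets x)"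
proof (rule jet_comor_eqI [OF comorphism_ident o o])
  let ?i = "Ident C (Cod C x)"
  have cod: "Cod C x \<in> Obj C"
    using o by simp
  have "jet_transport x ?i (Ident C (Dom C x) \<cdot> snd (pb ?i x)) x
      (Ident C (Dom C (jets x)) \<cdot> snd (pb ?i (jets x)))"
    using o by (intro jet_transport_vertical) (simp_all add: hom_set_def squareD(1-5))
  then show "jet_transport x ?i (snd (pb ?i x)) x (snd (pb ?i (jets x)))"
    using o cod by simp
qed (use o in simp)

lemma jet_fctr_functor:
  "is_functor (comorphisms C S pb) (comorphisms C S pb) jet_fctr"
proof -
  let ?E = "comorphisms C S pb"
  have obj: "x \<in> Obj ?E \<longleftrightarrow> over x" for x
    by (simp add: comorphisms_def over_def del: over_simps)
  have ends: "Dom ?E (x, \<alpha>, v, y) = x" "Cod ?E (x, \<alpha>, v, y) = y"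
    "Ident ?E x = (x, Ident C (Cod C x), snd (pb (Ident C (Cod C x)) x), x)" for x \<alpha> v y
    by (simp_all add: comorphisms_def)
  have "jet_comor f \<in> hom_set ?E (jets (Dom ?E f)) (jets (Cod ?E f))" if "f \<in> Arr ?E" for f
  proof (cases f)
    case (fields x \<alpha> v y)
    then have f: "comorphism x \<alpha> v y" "over x" "over y"
      using that by (simp_all add: arr_comorphisms_over)
    obtain w where "jet_transport x \<alpha> v y w" "jet_comor (x, \<alpha>, v, y) = (jets x, \<alpha>, w, jets y)"
      using jet_comor_cases [OF f] by blast
    then show ?thesis
      using fields f(2,3) by (simp add: hom_set_def ends arr_comorphisms_over jet_transport_def)
  qed
  moreover have "jet_comor (g \<cdot>\<^bsub>?E\<^esub> f) = jet_comor g \<cdot>\<^bsub>?E\<^esub> jet_comor f"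
    if f: "f \<in> Arr ?E" and g: "g \<in> Arr ?E" and fg: "Cod ?E f = Dom ?E g" for f g
  proof -
    obtain x \<alpha> v y \<beta> w z where [simp]: "f = (x, \<alpha>, v, y)" "g = (y, \<beta>, w, z)"
      using fg by (cases f; cases g) (simp add: ends)
    have cf: "comorphism x \<alpha> v y" and cg: "comorphism y \<beta> w z" and o: "over x" "over y" "over z"
      using f g by (simp_all add: arr_comorphisms_over)
    obtain v' where v': "jet_transport x \<alpha> v y v'" "jet_comor f = (jets x, \<alpha>, v', jets y)"
      using jet_comor_cases [OF cf o(1,2)] by auto
    obtain w' where w': "jet_transport y \<beta> w z w'" "jet_comor g = (jets y, \<beta>, w', jets z)"
      using jet_comor_cases [OF cg o(2,3)] by auto
    show ?thesis
      unfolding v'(2) w'(2) comp_comorphisms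
      using jet_comor_eqI [OF comorphism_comp [OF cf cg] o(1,3) jet_transport_comp [OF cf cg o v'(1) w'(1)]]
      by (simp add: comp_comorphisms)
  qed
  ultimately show ?thesis
    unfolding is_functor_def by (auto simp: jet_fctr_def obj ends jet_comor_ident)
qed

lemma jet_fctr_over_base:
  "functor_eq (comorphisms C S pb) (fctr_comp (base_proj C) jet_fctr) (base_proj C)"
proof -
  have "Cod C (jets x) = Cod C x" if "x \<in> Obj (comorphisms C S pb)" for x
    using that jet_obj [of x] by (simp add: comorphisms_def jets_def)
  then show ?thesis
    by (auto simp: functor_eq_def fctr_comp_def base_proj_def jet_fctr_def jet_comor_def)
qed

text \<open>
  Naturality of the counit is an equation at the generic element of \<open>d\<^sup>*(J X)\<close>; pulling it back along
  \<open>(n, s)\<close> gives the equation for all elements.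
\<close>

lemma jet_arr_value:
  assumes o: "over x" "over y" "Cod C x = B" "Cod C y = B"
    and u': "u' \<in> hom_set C (Dom C (jets x)) (Dom C (jets y))" "jets y \<cdot> u' = jets x"
    and u: "u \<in> hom_set C (Dom C x) (Dom C y)"
    and gen: "eval_jet y (fst (pb (d B) (jets x))) (u' \<cdot> snd (pb (d B) (jets x))) = u \<cdot> ev x"
    and sq: "square (d B) (jets x) n s"
  shows "eval_jet y n (u' \<cdot> s) = u \<cdot> eval_jet x n s"
proof -
  let ?n = "fst (pb (d B) (jets x))" and ?s = "snd (pb (d B) (jets x))" and ?t = "pair (d B) (jets x) n s"
  have B: "B \<in> S"
    using o by auto
  have sq0: "square (d B) (jets x) ?n ?s"
    using B o by (intro square_proj) simp_all
  have sq': "square (d (Cod C y)) (jets y) ?n (u' \<cdot> ?s)"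
    using square_jet_comp [OF o(2) _ _ _ _ u'(2), of ?n ?s] sq0 u' o by (simp add: hom_set_def)
  have evx: "ev x \<in> Arr C" "Dom C (ev x) = Dom C (fst (pb (d B) (jets x)))" "Cod C (ev x) = Dom C x"
    using over_simps(5,6) [OF o(1)] o(3) by (auto simp: from_pb_def)
  have "u \<cdot> eval_jet x n s = (u \<cdot> ev x) \<cdot> ?t"
    using sq evx u o by (simp add: eval_jet_def app_def hom_set_def)
  also have "\<dots> = eval_jet y ?n (u' \<cdot> ?s) \<cdot> ?t"
    by (simp only: gen)
  also have "\<dots> = eval_jet y (?n \<cdot> ?t) ((u' \<cdot> ?s) \<cdot> ?t)"
    using sq by (intro eval_jet_comp [OF o(2) sq']) simp_all
  also have "(u' \<cdot> ?s) \<cdot> ?t = u' \<cdot> (?s \<cdot> ?t)"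
    using sq u' squareD(1-5) [OF sq0] by (intro comp_assoc) (simp_all add: hom_set_def)
  finally show ?thesis
    using sq by simp
qed

lemma jet_fctr_on_fibre:
  assumes B: "B \<in> S"
  shows "functor_eq (dual (slice C B)) (fctr_comp jet_fctr (fibre_incl C pb B))
    (fctr_comp (fibre_incl C pb B) (JB B))"
proof -
  have "jet_comor (farr (fibre_incl C pb B) (x, u, y)) = farr (fibre_incl C pb B) (farr (JB B) (x, u, y))"
    if f: "(x, u, y) \<in> Arr (slice C B)" for x u y
  proof -
    have o: "over x" "over y" "Cod C x = B" "Cod C y = B"
      and u: "u \<in> hom_set C (Dom C x) (Dom C y)" "y \<cdot> u = x"
      using f B by (auto simp: slice_def over_def simp del: over_simps)
    have J: "fobj (JB B) x = jets x" "fobj (JB B) y = jets y"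
      using o by (simp_all add: jets_def)
    obtain u' where u': "u' \<in> hom_set C (Dom C (jets x)) (Dom C (jets y))" "jets y \<cdot> u' = jets x"
      and eq: "farr (JB B) (x, u, y) = (jets x, u', jets y)"
      and gen: "eval_jet y (fst (pb (d B) (jets x))) (u' \<cdot> snd (pb (d B) (jets x))) = u \<cdot> ev x"
      using jet_arr [OF B f] unfolding J eval_jet_def o(4) by auto
    have "jet_transport y (Ident C (Cod C y)) (u \<cdot> snd (pb (Ident C (Cod C y)) x)) x
        (u' \<cdot> snd (pb (Ident C (Cod C y)) (jets x)))"
    proof (rule jet_transport_vertical [OF o(1,2) _ u u'])
      show "eval_jet y n (u' \<cdot> s) = u \<cdot> eval_jet x n s" if "square (d (Cod C y)) (jets x) n s" for n s
        by (rule jet_arr_value [OF o u' u(1) gen]) (use that o(4) in simp)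
    qed (simp add: o)
    moreover have "comorphism y (Ident C (Cod C y)) (u \<cdot> snd (pb (Ident C (Cod C y)) x)) x"
      using o u by (intro comorphism_vertical) simp_all
    ultimately have "jet_comor (y, Ident C B, u \<cdot> snd (pb (Ident C B) x), x) =
        (jets y, Ident C B, u' \<cdot> snd (pb (Ident C B) (jets x)), jets x)"
      using jet_comor_eqI o by simp
    then show ?thesis
      by (simp add: fibre_incl_def eq)
  qed
  then show ?thesis
    by (auto simp: functor_eq_def fctr_comp_def jet_fctr_def dual_def fibre_incl_def slice_def jets_def)
qed

end


section \<open>The evaluation of jets from a right adjoint\<close>

context generalized_elements
begin

lemma slice_obj: "x \<in> Obj (slice C B) \<longleftrightarrow> x \<in> Arr C \<and> Cod C x = B"
  by (simp add: slice_def)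

lemma slice_hom_iff:
  "(x', u, y') \<in> hom_set (slice C B) x y \<longleftrightarrow> x' = x \<and> y' = y \<and> x \<in> Arr C \<and> Cod C x = B \<and>
     y \<in> Arr C \<and> Cod C y = B \<and> u \<in> hom_set C (Dom C x) (Dom C y) \<and> y \<cdot> u = x"
  by (auto simp: slice_def hom_set_def)

lemma slice_homE:
  assumes "f \<in> hom_set (slice C B) x y"
  obtains u where "f = (x, u, y)" "u \<in> hom_set C (Dom C x) (Dom C y)" "y \<cdot> u = x"
proof (cases f)
  case (fields x' u y')
  then show ?thesis
    using assms that by (simp add: slice_hom_iff)
qed

lemma slice_comp: "(y', w, z) \<cdot>\<^bsub>slice C B\<^esub> (x, u, y) = (x, w \<cdot> u, z)"
  by (simp add: slice_def)

lemma slice_dom_cod: "Dom (slice C B) (x, u, y) = x" "Cod (slice C B) (x, u, y) = y"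
  by (simp_all add: slice_def)

lemma pb_fctr_simps:
  "fobj (pb_fctr C pb \<alpha>) y = fst (pb \<alpha> y)"
  "farr (pb_fctr C pb \<alpha>) (y, u, z) =
     (fst (pb \<alpha> y), pair \<alpha> z (fst (pb \<alpha> y)) (u \<cdot> snd (pb \<alpha> y)), fst (pb \<alpha> z))"
  by (simp_all add: pb_fctr_def)

lemma square_pb_fctr:
  assumes "\<alpha> \<in> Arr C" "y \<in> Arr C" "z \<in> Arr C" "Cod C \<alpha> = Cod C y" "Cod C \<alpha> = Cod C z"
    "u \<in> hom_set C (Dom C y) (Dom C z)" "z \<cdot> u = y"
  shows "square \<alpha> z (fst (pb \<alpha> y)) (u \<cdot> snd (pb \<alpha> y))"
proof -
  have "z \<cdot> (u \<cdot> snd (pb \<alpha> y)) = (z \<cdot> u) \<cdot> snd (pb \<alpha> y)"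
    using assms(1-6) by (intro comp_assoc [symmetric]) (simp_all add: hom_set_def)
  also have "\<dots> = \<alpha> \<cdot> fst (pb \<alpha> y)"
    using assms(1-5) by (simp add: assms(7))
  finally show ?thesis
    using assms(1-6) by (simp add: square_def hom_set_def)
qed

text \<open>
  The counit at \<open>c\<^sup>*Y\<close> followed by the projection to \<open>Y\<close> inherits its universal property, because a map
  into \<open>c\<^sup>*Y\<close> over \<open>N\<close> is the same as a map to \<open>Y\<close> covering \<open>c\<close>.
\<close>

lemma jet_evaluation_exists:
  assumes adj: "right_adjoint (slice C B) (slice C N) (pb_fctr C pb d) R"
    and d: "d \<in> hom_set C N B" and c: "c \<in> hom_set C N B"
  defines "J \<equiv> fctr_comp R (pb_fctr C pb c)"
  shows "\<exists>ev. jet_evaluation B d c J ev"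
proof -
  let ?B = "slice C B" and ?N = "slice C N"
  let ?c = "\<lambda>y. fst (pb c y)"
  have [simp]: "d \<in> Arr C" "Dom C d = N" "Cod C d = B" "c \<in> Arr C" "Dom C c = N" "Cod C c = B"
    using d c by (auto simp: hom_set_def)
  obtain \<epsilon> where R: "is_functor ?N ?B R"
    and \<epsilon>_hom: "\<forall>Y\<in>Obj ?N. \<epsilon> Y \<in> hom_set ?N (fst (pb d (fobj R Y))) Y"
    and \<epsilon>_nat: "\<forall>h\<in>Arr ?N.
      h \<cdot>\<^bsub>?N\<^esub> \<epsilon> (Dom ?N h) = \<epsilon> (Cod ?N h) \<cdot>\<^bsub>?N\<^esub> farr (pb_fctr C pb d) (farr R h)"
    and \<epsilon>_univ: "\<forall>X\<in>Obj ?B. \<forall>Y\<in>Obj ?N. \<forall>f\<in>hom_set ?N (fst (pb d X)) Y.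
      \<exists>!g. g \<in> hom_set ?B X (fobj R Y) \<and> \<epsilon> Y \<cdot>\<^bsub>?N\<^esub> farr (pb_fctr C pb d) g = f"
    using adj unfolding right_adjoint_def pb_fctr_simps by (elim conjE exE) (rule that)
  define e where "e y = fst (snd (\<epsilon> (?c y)))" for y
  define ev where "ev y = snd (pb c y) \<cdot> e y" for y
  have J: "fobj J y = fobj R (?c y)" "farr J f = farr R (farr (pb_fctr C pb c) f)" for y f
    by (simp_all add: J_def fctr_comp_def pb_fctr_simps)
  have cy [simp]: "?c y \<in> Arr C" "Cod C (?c y) = N" if "y \<in> Arr C" "Cod C y = B" for y
    using that by simp_all
  have Jy: "fobj J y \<in> Arr C" "Cod C (fobj J y) = B" if "y \<in> Arr C" "Cod C y = B" for y
    using R cy [OF that] unfolding is_functor_def J by (auto simp: slice_obj)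
  have e: "\<epsilon> (?c y) = (fst (pb d (fobj J y)), e y, ?c y)" "e y \<in> Arr C"
    "Dom C (e y) = Dom C (fst (pb d (fobj J y)))" "Cod C (e y) = Dom C (?c y)"
    "?c y \<cdot> e y = fst (pb d (fobj J y))" if "y \<in> Arr C" "Cod C y = B" for y
  proof -
    have "\<epsilon> (?c y) \<in> hom_set ?N (fst (pb d (fobj J y))) (?c y)"
      using \<epsilon>_hom cy [OF that] by (simp add: slice_obj J)
    then obtain u where "\<epsilon> (?c y) = (fst (pb d (fobj J y)), u, ?c y)"
      "u \<in> hom_set C (Dom C (fst (pb d (fobj J y)))) (Dom C (?c y))" "?c y \<cdot> u = fst (pb d (fobj J y))"
      by (rule slice_homE)
    then show "\<epsilon> (?c y) = (fst (pb d (fobj J y)), e y, ?c y)" "e y \<in> Arr C"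
      "Dom C (e y) = Dom C (fst (pb d (fobj J y)))" "Cod C (e y) = Dom C (?c y)"
      "?c y \<cdot> e y = fst (pb d (fobj J y))"
      by (simp_all add: e_def hom_set_def)
  qed
  have ev: "from_pb d (fobj J y) (ev y)" "Cod C (ev y) = Dom C y"
    "y \<cdot> ev y = c \<cdot> fst (pb d (fobj J y))" if y: "y \<in> Arr C" "Cod C y = B" for y
  proof -
    note [simp] = e(2-4) [OF y] y
    show "from_pb d (fobj J y) (ev y)" "Cod C (ev y) = Dom C y"
      by (simp_all add: ev_def from_pb_def)
    have "y \<cdot> ev y = (y \<cdot> snd (pb c y)) \<cdot> e y"
      unfolding ev_def by (intro comp_assoc [symmetric]) simp_all
    also have "\<dots> = c \<cdot> (?c y \<cdot> e y)"
      by simp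
    finally show "y \<cdot> ev y = c \<cdot> fst (pb d (fobj J y))"
      by (simp only: e(5) [OF y])
  qed
  have app_ev: "app d (fobj J y) (ev y) a b = snd (pb c y) \<cdot> (e y \<cdot> pair d (fobj J y) a b)"
    if y: "y \<in> Arr C" "Cod C y = B" and sq: "square d (fobj J y) a b" for y a b
    using y sq e(2-4) [OF y] by (simp add: app_def ev_def)
  have univ: "\<exists>!g. g \<in> hom_set C (Dom C p) (Dom C (fobj J y)) \<and> fobj J y \<cdot> g = p \<and>
      app d (fobj J y) (ev y) (fst (pb d p)) (g \<cdot> snd (pb d p)) = h"
    if y: "y \<in> Arr C" "Cod C y = B" and p: "p \<in> Arr C" "Cod C p = B"
      and h: "from_pb d p h" "Cod C h = Dom C y" "y \<cdot> h = c \<cdot> fst (pb d p)" for y p h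
  proof -
    note [simp] = Jy [OF y] y p e(2-4) [OF y]
    define k where "k = pair c y (fst (pb d p)) h"
    have sqk: "square c y (fst (pb d p)) h"
      using h by (simp add: square_def from_pb_def)
    have "(fst (pb d p), k, ?c y) \<in> hom_set ?N (fst (pb d p)) (?c y)"
      unfolding slice_hom_iff using sqk by (simp add: k_def hom_set_def [of C])
    then have ex: "\<exists>!G. G \<in> hom_set ?B p (fobj J y) \<and>
        \<epsilon> (?c y) \<cdot>\<^bsub>?N\<^esub> farr (pb_fctr C pb d) G = (fst (pb d p), k, ?c y)"
      unfolding J by (intro \<epsilon>_univ [rule_format]) (simp_all add: slice_obj)
    \<comment> \<open>Both sides are maps into \<open>c\<^sup>*Y\<close> over \<open>N\<close>, so they agree iff their projections to \<open>Y\<close> do.\<close>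
    have iff: "\<epsilon> (?c y) \<cdot>\<^bsub>?N\<^esub> farr (pb_fctr C pb d) (p, g, fobj J y) = (fst (pb d p), k, ?c y) \<longleftrightarrow>
        app d (fobj J y) (ev y) (fst (pb d p)) (g \<cdot> snd (pb d p)) = h"
      if g: "g \<in> hom_set C (Dom C p) (Dom C (fobj J y))" "fobj J y \<cdot> g = p" for g
    proof -
      have sq: "square d (fobj J y) (fst (pb d p)) (g \<cdot> snd (pb d p))"
        using g by (intro square_pb_fctr) simp_all
      define m where "m = e y \<cdot> pair d (fobj J y) (fst (pb d p)) (g \<cdot> snd (pb d p))"
      have m: "m \<in> Arr C" "Cod C m = Dom C (?c y)"
        using sq by (simp_all add: m_def)
      have "?c y \<cdot> m = (?c y \<cdot> e y) \<cdot> pair d (fobj J y) (fst (pb d p)) (g \<cdot> snd (pb d p))"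
        unfolding m_def using sq by (intro comp_assoc [symmetric]) simp_all
      then have "?c y \<cdot> m = fst (pb d p)"
        using sq by (simp add: e(5) [OF y])
      then have "k = m \<longleftrightarrow> snd (pb c y) \<cdot> m = h"
        unfolding k_def using pair_eqI [OF sqk m] pair_arr(5) [OF sqk] by auto
      then show ?thesis
        unfolding app_ev [OF y sq] m_def [symmetric]
        by (auto simp: e(1) [OF y] pb_fctr_simps slice_comp m_def)
    qed
    define Q where "Q g \<longleftrightarrow> g \<in> hom_set C (Dom C p) (Dom C (fobj J y)) \<and> fobj J y \<cdot> g = p \<and>
      app d (fobj J y) (ev y) (fst (pb d p)) (g \<cdot> snd (pb d p)) = h" for g
    have Q: "(p, g, fobj J y) \<in> hom_set ?B p (fobj J y) \<and>
        \<epsilon> (?c y) \<cdot>\<^bsub>?N\<^esub> farr (pb_fctr C pb d) (p, g, fobj J y) = (fst (pb d p), k, ?c y) \<longleftrightarrow> Q g" for g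
      using iff [of g] Jy [OF y] p unfolding Q_def slice_hom_iff by blast
    have "G \<in> hom_set ?B p (fobj J y) \<and>
        \<epsilon> (?c y) \<cdot>\<^bsub>?N\<^esub> farr (pb_fctr C pb d) G = (fst (pb d p), k, ?c y) \<longleftrightarrow>
        (\<exists>g. G = (p, g, fobj J y) \<and> Q g)" for G
      using Q by (metis slice_homE)
    with ex have "\<exists>!G. \<exists>g. G = (p, g, fobj J y) \<and> Q g"
      by (simp only:)
    then have "\<exists>!g. Q g"
      by blast
    then show ?thesis
      by (simp only: Q_def)
  qed
  have arr: "\<exists>u'\<in>hom_set C (Dom C (fobj J x)) (Dom C (fobj J y)).
      farr J (x, u, y) = (fobj J x, u', fobj J y) \<and> fobj J y \<cdot> u' = fobj J x \<and>
      app d (fobj J y) (ev y) (fst (pb d (fobj J x))) (u' \<cdot> snd (pb d (fobj J x))) = u \<cdot> ev x"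
    if f: "(x, u, y) \<in> Arr ?B" for x u y
  proof -
    have x: "x \<in> Arr C" "Cod C x = B" and y: "y \<in> Arr C" "Cod C y = B"
      and u: "u \<in> hom_set C (Dom C x) (Dom C y)" "y \<cdot> u = x"
      using f by (auto simp: slice_def)
    note [simp] = x y Jy [OF x] Jy [OF y] e(2-4) [OF x] e(2-4) [OF y]
    define m where "m = pair c y (?c x) (u \<cdot> snd (pb c x))"
    have sqm: "square c y (?c x) (u \<cdot> snd (pb c x))"
      using u by (intro square_pb_fctr) simp_all
    have m [simp]: "m \<in> Arr C" "Dom C m = Dom C (?c x)" "Cod C m = Dom C (?c y)"
      and m_proj: "?c y \<cdot> m = ?c x" "snd (pb c y) \<cdot> m = u \<cdot> snd (pb c x)"
      using sqm by (simp_all add: m_def)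
    have F: "(?c x, m, ?c y) \<in> Arr ?N"
      using m_proj by (simp add: slice_def hom_set_def)
    have "farr R (?c x, m, ?c y) \<in> hom_set ?B (fobj J x) (fobj J y)"
      using R F unfolding is_functor_def J by (metis slice_dom_cod)
    then obtain u' where u': "farr R (?c x, m, ?c y) = (fobj J x, u', fobj J y)"
      "u' \<in> hom_set C (Dom C (fobj J x)) (Dom C (fobj J y))" "fobj J y \<cdot> u' = fobj J x"
      by (rule slice_homE)
    have sq: "square d (fobj J y) (fst (pb d (fobj J x))) (u' \<cdot> snd (pb d (fobj J x)))"
      using u' by (intro square_pb_fctr) simp_all
    have nat: "m \<cdot> e x = e y \<cdot> pair d (fobj J y) (fst (pb d (fobj J x))) (u' \<cdot> snd (pb d (fobj J x)))"
      using bspec [OF \<epsilon>_nat F] by (simp add: slice_dom_cod e(1) u'(1) pb_fctr_simps slice_comp)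
    have "app d (fobj J y) (ev y) (fst (pb d (fobj J x))) (u' \<cdot> snd (pb d (fobj J x))) =
        snd (pb c y) \<cdot> (m \<cdot> e x)"
      by (simp only: app_ev [OF y sq] nat)
    also have "\<dots> = (snd (pb c y) \<cdot> m) \<cdot> e x"
      by (intro comp_assoc [symmetric]) simp_all
    also have "\<dots> = u \<cdot> ev x"
      unfolding m_proj ev_def using u by (intro comp_assoc) (simp_all add: hom_set_def)
    finally show ?thesis
      using u' by (auto simp: J(2) pb_fctr_simps m_def)
  qed
  have "jet_evaluation B d c J ev"
    unfolding jet_evaluation_def using Jy ev univ arr by (intro conjI ballI allI impI) blast+
  then show ?thesis
    by (rule exI [of _ ev])
qed

text \<open>
  Evaluations are chosen separately for each base object; as they concern disjoint collections of
  bundles, they can be glued to one function.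
\<close>

lemma jet_evaluation_cong:
  assumes "jet_evaluation B d c J ev" and eq: "\<And>y. y \<in> Arr C \<Longrightarrow> Cod C y = B \<Longrightarrow> ev y = ev' y"
  shows "jet_evaluation B d c J ev'"
proof -
  have "(x, u, y) \<in> Arr (slice C B) \<Longrightarrow> ev x = ev' x \<and> ev y = ev' y" for x u y
    using eq by (auto simp: slice_def)
  with assms show ?thesis
    unfolding jet_evaluation_def by simp
qed

end

section \<open>The fibres of the fibrewise dual\<close>

text \<open>
  On arrows the inclusion is pre-composition with the invertible projection \<open>id\<^sup>*X \<rightarrow> X\<close>, hence
  bijective.  Composition reverses because a comorphism over an identity is given by a map in the
  opposite direction.
\<close>

lemma (in generalized_elements) fibre_incl_isomorphism:
  assumes B: "B \<in> S" "B \<in> Obj C"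
  shows "is_isomorphism (dual (slice C B)) (fibre (comorphisms C S pb) (full_subcat C S) (base_proj C) B)
    (fibre_incl C pb B)"
proof -
  let ?i = "Ident C B"
  let ?D = "dual (slice C B)" and ?F = "fibre (comorphisms C S pb) (full_subcat C S) (base_proj C) B"
  have objF: "x \<in> Obj ?F \<longleftrightarrow> x \<in> Arr C \<and> Cod C x = B" for x
    using B by (auto simp: fibre_def comorphisms_def base_proj_def)
  have arrF: "(y, \<alpha>, v, x) \<in> Arr ?F \<longleftrightarrow> \<alpha> = ?i \<and> comorphism y ?i v x \<and> Cod C x = B \<and> Cod C y = B"
    for y \<alpha> v x
    using B by (auto simp: fibre_def arr_comorphisms_iff)
      (auto simp: comorphisms_def base_proj_def full_subcat_def)
  have opsF: "Dom ?F (y, \<alpha>, v, x) = y" "Cod ?F (y, \<alpha>, v, x) = x"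
    "Ident ?F x = (x, Ident C (Cod C x), snd (pb (Ident C (Cod C x)) x), x)"
    "g \<cdot>\<^bsub>?F\<^esub> f = g \<cdot>\<^bsub>comorphisms C S pb\<^esub> f" for x y \<alpha> v f g
    by (simp_all add: fibre_def comorphisms_def)
  have arrD: "(x, u, y) \<in> Arr ?D \<longleftrightarrow> x \<in> Arr C \<and> Cod C x = B \<and> y \<in> Arr C \<and> Cod C y = B \<and>
      u \<in> hom_set C (Dom C x) (Dom C y) \<and> y \<cdot> u = x" for x u y
    by (auto simp: dual_def slice_def)
  have opsD: "Dom ?D (x, u, y) = y" "Cod ?D (x, u, y) = x" "Ident ?D x = (x, Ident C (Dom C x), x)"
    "(x', u', y') \<cdot>\<^bsub>?D\<^esub> (x, u, y) = (x', u \<cdot> u', y)" "Obj ?D = {x \<in> Arr C. Cod C x = B}"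
    for x u y x' u' y'
    by (simp_all add: dual_def slice_def)
  have incl: "farr (fibre_incl C pb B) (x, u, y) = (y, ?i, u \<cdot> snd (pb ?i x), x)" "fobj (fibre_incl C pb B) x = x"
    for x u y
    by (simp_all add: fibre_incl_def)
  have vert: "comorphism y ?i (u \<cdot> snd (pb ?i x)) x" if "(x, u, y) \<in> Arr ?D" for x u y
    using that comorphism_vertical [of x y u] by (auto simp: arrD)
  have comp: "farr (fibre_incl C pb B) (g \<cdot>\<^bsub>?D\<^esub> f) =
      farr (fibre_incl C pb B) g \<cdot>\<^bsub>?F\<^esub> farr (fibre_incl C pb B) f"
    if fg: "f \<in> Arr ?D" "g \<in> Arr ?D" "Cod ?D f = Dom ?D g" for f g
  proof -
    obtain x u y z w where fg_eq: "f = (x, u, y)" "g = (z, w, x)"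
      using fg(3) by (cases f; cases g) (simp add: opsD)
    have f: "(x, u, y) \<in> Arr ?D" and g: "(z, w, x) \<in> Arr ?D"
      using fg by (simp_all add: fg_eq)
    have typing [simp]: "x \<in> Arr C" "y \<in> Arr C" "z \<in> Arr C" "Cod C x = B" "Cod C y = B" "Cod C z = B"
      "u \<in> Arr C" "Dom C u = Dom C x" "Cod C u = Dom C y" "w \<in> Arr C" "Dom C w = Dom C z" "Cod C w = Dom C x"
      using f g by (auto simp: arrD hom_set_def)
    have ii: "?i \<cdot> ?i = ?i"
      using B by simp
    define a b where "a = fst (pb ?i z)" and "b = snd (pb ?i z)"
    have ab: "a \<in> Arr C" "Cod C a = B" "b \<in> Arr C" "Dom C b = Dom C a" "Cod C b = Dom C z"
      using B by (simp_all add: a_def b_def)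
    note gen = comp_vertical_generic [OF vert [OF f] vert [OF g], unfolded ii, folded a_def b_def]
    have ia: "?i \<cdot> a = a"
      using ab by simp
    have sqz: "square ?i z a b"
      unfolding a_def b_def using B by (intro square_proj) simp_all
    have inner: "app ?i z (w \<cdot> b) a b = w \<cdot> b"
      unfolding b_def using B sqz [unfolded b_def] by (intro app_vertical) simp_all
    have "square ?i x a (w \<cdot> b)"
      using gen(1) by (simp only: ia inner)
    then have "app ?i x (u \<cdot> snd (pb ?i x)) a (w \<cdot> b) = u \<cdot> (w \<cdot> b)"
      using B by (intro app_vertical) simp_all
    then have "comp_vertical ?i (u \<cdot> snd (pb ?i x)) x ?i (w \<cdot> b) z = u \<cdot> (w \<cdot> b)"
      unfolding gen(2) by (simp only: ia inner)
    moreover have "(u \<cdot> w) \<cdot> b = u \<cdot> (w \<cdot> b)"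
      using ab by (intro comp_assoc) simp_all
    ultimately show ?thesis
      by (simp add: fg_eq opsD opsF incl comp_comorphisms ii b_def)
  qed
  have "farr (fibre_incl C pb B) f \<in> hom_set ?F (Dom ?D f) (Cod ?D f)" if "f \<in> Arr ?D" for f
  proof (cases f)
    case (fields x u y)
    then show ?thesis
      using that vert [of x u y] arrD [of x u y]
      by (simp add: incl opsF opsD arrF hom_set_def [of ?F])
  qed
  moreover have "farr (fibre_incl C pb B) (Ident ?D x) = Ident ?F x" if "x \<in> Obj ?D" for x
    using that B by (simp add: opsD opsF incl)
  ultimately have fctr: "is_functor ?D ?F (fibre_incl C pb B)"
    unfolding is_functor_def using comp by (auto simp: incl(2) objF opsD(5))
  have "bij_betw (farr (fibre_incl C pb B)) (Arr ?D) (Arr ?F)"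
  proof (rule bij_betw_imageI)
    show "inj_on (farr (fibre_incl C pb B)) (Arr ?D)"
    proof (rule inj_onI)
      fix f g assume fg: "f \<in> Arr ?D" "g \<in> Arr ?D"
        and eq: "farr (fibre_incl C pb B) f = farr (fibre_incl C pb B) g"
      obtain x u y w where fg_eq: "f = (x, u, y)" "g = (x, w, y)" and uw: "u \<cdot> snd (pb ?i x) = w \<cdot> snd (pb ?i x)"
        using eq by (cases f; cases g) (auto simp: incl)
      have x: "x \<in> Arr C" "Cod C x = B" and u: "u \<in> Arr C" "Dom C u = Dom C x" and w: "w \<in> Arr C" "Dom C w = Dom C x"
        using fg by (auto simp: fg_eq arrD hom_set_def)
      note iso = pb_ident_iso [OF x(1), unfolded x(2)]
      let ?t = "pair ?i x x (Ident C (Dom C x))"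
      have "u = (u \<cdot> snd (pb ?i x)) \<cdot> ?t" "w = (w \<cdot> snd (pb ?i x)) \<cdot> ?t"
        using iso(1) x u w B by simp_all
      then show "f = g"
        by (simp only: fg_eq uw)
    qed
    have "f \<in> farr (fibre_incl C pb B) ` Arr ?D" if "f \<in> Arr ?F" for f
    proof -
      obtain y \<alpha> v x where f: "f = (y, \<alpha>, v, x)"
        by (cases f)
      have \<alpha>: "\<alpha> = ?i" and v: "comorphism y ?i v x" and xy: "Cod C x = B" "Cod C y = B"
        using that by (auto simp: f arrF)
      have arrs: "x \<in> Arr C" "y \<in> Arr C" "v \<in> Arr C" "Dom C v = Dom C (fst (pb ?i x))" "Cod C v = Dom C y"
        "y \<cdot> v = fst (pb ?i x)"
        using v by (auto simp: comorphism_def from_pb_def)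
      \<comment> \<open>\<open>v\<close> comes from the arrow \<open>v \<circ> (x, id)\<close> of the slice.\<close>
      let ?t = "pair ?i x x (Ident C (Dom C x))"
      note iso = pb_ident_iso [OF arrs(1), unfolded xy(1)]
      have t: "?t \<in> Arr C" "Dom C ?t = Dom C x" "Cod C ?t = Dom C (fst (pb ?i x))" "fst (pb ?i x) \<cdot> ?t = x"
        using pair_arr [OF iso(1)] by simp_all
      have "y \<cdot> (v \<cdot> ?t) = (y \<cdot> v) \<cdot> ?t"
        using arrs(1-5) t(1-3) by (intro comp_assoc [symmetric]) simp_all
      then have "y \<cdot> (v \<cdot> ?t) = x"
        by (simp only: arrs(6) t(4))
      then have "(x, v \<cdot> ?t, y) \<in> Arr ?D"
        using arrs(1-5) t xy by (simp add: arrD hom_set_def)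
      moreover have "(v \<cdot> ?t) \<cdot> snd (pb ?i x) = v \<cdot> (?t \<cdot> snd (pb ?i x))"
        using arrs t xy B by (intro comp_assoc) simp_all
      then have "(v \<cdot> ?t) \<cdot> snd (pb ?i x) = v"
        using arrs(3,4) by (simp only: iso(2) comp_ident)
      then have "f = farr (fibre_incl C pb B) (x, v \<cdot> ?t, y)"
        by (simp only: f \<alpha> incl)
      ultimately show ?thesis
        by blast
    qed
    moreover have "farr (fibre_incl C pb B) f \<in> Arr ?F" if "f \<in> Arr ?D" for f
      using fctr that unfolding is_functor_def hom_set_def by blast
    ultimately show "farr (fibre_incl C pb B) ` Arr ?D = Arr ?F"
      by blast
  qed
  moreover have "bij_betw (fobj (fibre_incl C pb B)) (Obj ?D) (Obj ?F)"
    using objF opsD(5) by (auto simp: bij_betw_def inj_on_def incl)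
  ultimately show ?thesis
    using fctr by (simp add: is_isomorphism_def)
qed

section \<open>The jet functor of a model of synthetic differential geometry\<close>

theorem theorem11p1:
  fixes C :: "('o, 'a) cat"
    and \<iota> :: "(manifold, smooth_arrow, 'o, 'a) fctr"
    and k :: nat
    and d c :: "'o \<Rightarrow> 'a"
    and pb :: "'a \<Rightarrow> 'a \<Rightarrow> 'a \<times> 'a"
    and Pif :: "'a \<Rightarrow> ('a, 'a \<times> 'a \<times> 'a, 'a, 'a \<times> 'a \<times> 'a) fctr"
  assumes "sdg_model C \<iota>"
    and "diagonal_nbhds C \<iota> k d c"
    and "pullback_choice C pb"
    and "pi_choice C pb Pif"
  shows "\<exists>J. is_functor (comorphisms C (base_objects \<iota>) pb) (comorphisms C (base_objects \<iota>) pb) J \<and>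
             functor_eq (comorphisms C (base_objects \<iota>) pb) (fctr_comp (base_proj C) J) (base_proj C) \<and>
             (\<forall>B\<in>base_objects \<iota>.
                is_isomorphism (dual (slice C B))
                  (fibre (comorphisms C (base_objects \<iota>) pb) (full_subcat C (base_objects \<iota>)) (base_proj C) B)
                  (fibre_incl C pb B) \<and>
                functor_eq (dual (slice C B))
                  (fctr_comp J (fibre_incl C pb B))
                  (fctr_comp (fibre_incl C pb B) (dual_fctr (jet C pb Pif d c B))))"
proof -
  let ?S = "base_objects \<iota>"
  interpret generalized_elements C pb
    using assms(1,3) by unfold_locales (simp_all add: sdg_model_def is_topos_def)
  have nbhd: "is_nbhd C \<iota> k M (d (fobj \<iota> M)) (c (fobj \<iota> M))" if "is_manifold M" for M
    using assms(2) that by (simp add: diagonal_nbhds_def)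
  have dc: "d B \<in> hom_set C (Dom C (d B)) B" "c B \<in> hom_set C (Dom C (d B)) B"
    and mono: "\<And>X u v. \<lbrakk>X \<in> Obj C; u \<in> hom_set C X (Dom C (d B)); v \<in> hom_set C X (Dom C (d B));
      d B \<cdot>\<^bsub>C\<^esub> u = d B \<cdot>\<^bsub>C\<^esub> v; c B \<cdot>\<^bsub>C\<^esub> u = c B \<cdot>\<^bsub>C\<^esub> v\<rbrakk> \<Longrightarrow> u = v" if B: "B \<in> ?S" for B
  proof -
    obtain M where M: "is_manifold M" "B = fobj \<iota> M"
      using B by (auto simp: base_objects_def)
    note n = nbhd [OF M(1), folded M(2), unfolded is_nbhd_def]
    show "d B \<in> hom_set C (Dom C (d B)) B" "c B \<in> hom_set C (Dom C (d B)) B"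
      using n by (simp_all only: M(2) simp_thms)
    show "u = v" if "X \<in> Obj C" "u \<in> hom_set C X (Dom C (d B))" "v \<in> hom_set C X (Dom C (d B))"
      "d B \<cdot>\<^bsub>C\<^esub> u = d B \<cdot>\<^bsub>C\<^esub> v" "c B \<cdot>\<^bsub>C\<^esub> u = c B \<cdot>\<^bsub>C\<^esub> v" for X u v
      using n [THEN conjunct2, THEN conjunct2, THEN conjunct1] that by blast
  qed
  have dc': "d B \<in> Arr C" "Cod C (d B) = B" "c B \<in> Arr C" "Dom C (c B) = Dom C (d B)" "Cod C (c B) = B"
    if "B \<in> ?S" for B
    using dc [OF that] by (simp_all add: hom_set_def)
  have "\<exists>ev. jet_evaluation B (d B) (c B) (jet C pb Pif d c B) ev" if B: "B \<in> ?S" for B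
    unfolding jet_def
  proof (rule jet_evaluation_exists [OF _ dc [OF B]])
    show "right_adjoint (slice C B) (slice C (Dom C (d B))) (pb_fctr C pb (d B)) (Pif (d B))"
      using assms(4) dc' [OF B] unfolding pi_choice_def by metis
  qed
  then obtain e where e: "\<And>B. B \<in> ?S \<Longrightarrow> jet_evaluation B (d B) (c B) (jet C pb Pif d c B) (e B)"
    by metis
  interpret jet_bundles C pb ?S d c "jet C pb Pif d c" "\<lambda>y. e (Cod C y) y"
  proof unfold_locales
    show "u = v" if "B \<in> ?S" "u \<in> Arr C" "v \<in> Arr C" "Dom C u = Dom C v" "Cod C u = Dom C (d B)"
      "Cod C v = Dom C (d B)" "d B \<cdot>\<^bsub>C\<^esub> u = d B \<cdot>\<^bsub>C\<^esub> v" "c B \<cdot>\<^bsub>C\<^esub> u = c B \<cdot>\<^bsub>C\<^esub> v" for B u v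
      using that by (intro mono [of B "Dom C u" u v]) (simp_all add: hom_set_def)
    show "\<exists>\<alpha>'\<in>hom_set C (Dom C (d A)) (Dom C (d B)).
        d B \<cdot>\<^bsub>C\<^esub> \<alpha>' = \<alpha> \<cdot>\<^bsub>C\<^esub> d A \<and> c B \<cdot>\<^bsub>C\<^esub> \<alpha>' = \<alpha> \<cdot>\<^bsub>C\<^esub> c A"
      if "A \<in> ?S" "B \<in> ?S" "\<alpha> \<in> hom_set C A B" for A B \<alpha>
      using assms(2) that unfolding diagonal_nbhds_def by blast
    show "jet_evaluation B (d B) (c B) (jet C pb Pif d c B) (\<lambda>y. e (Cod C y) y)" if "B \<in> ?S" for B
      using e [OF that] by (rule jet_evaluation_cong) simp
  qed (use dc' in simp_all)
  have obj: "B \<in> Obj C" if "B \<in> ?S" for B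
    using obj_of_arr(2) [OF dc'(1) [OF that]] dc'(2) [OF that] by simp
  show ?thesis
    using jet_fctr_functor jet_fctr_over_base fibre_incl_isomorphism [OF _ obj] jet_fctr_on_fibre
    unfolding dual_fctr_def by blast
qed

end
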